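(* Let $p$ be a prime, $\Bbbk$ a field of characteristic $p$, $G=\langle\sigma\rangle$ of order $p$ acting on $V=V_2\oplus V_2$ so that on the dual basis $\sigma x_1=x_1+x_3$, $\sigma x_2=x_2+x_4$, $\sigma x_3=x_3$, $\sigma x_4=x_4$. Let $A=\Bbbk[x_1^p-x_1x_3^{p-1},\ x_2^p-x_2x_4^{p-1},\ x_3,\ x_4]$, $u=x_1x_4-x_2x_3$, and $1\le n\le p$. For $k\ge0$ let $M_k=\{x_1^ix_2^j: i+j=k,\ 0\le i<p,\ 0\le j<p\}$, and write $fM_k=\{fm:m\in M_k\}$ and $\Delta^rM_k=\{\Delta^r(m):m\in M_k\}$. Then $K_n=\ker(\Delta^n:\Bbbk[V]\to\Bbbk[V])$ is a free $A$-module with basis $S=M\cup U\cup D$, where \[M=\bigcup_{k=0}^{n-1}M_k,\qquad U=\bigcup_{k=1}^{p-n}u^kM_{n-1},\qquad D=\bigcup_{k=2p-n}^{2p-2}\Delta^{p-n}M_k.\]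
   Context: $\Delta=\sigma-\iota\in\Bbbk G$ acting on $\Bbbk[V]=\Bbbk[x_1,x_2,x_3,x_4]$. *)

theory Defs
  imports Main "HOL-Computational_Algebra.Primes" "HOL-Library.Poly_Mapping" "HOL-Library.Product_Plus"
begin

text \<open>Polynomials in four variables x1,x2,x3,x4 over 'k: finitely supported maps
  from exponent vectors (a,b,c,d) (monomial x1^a x2^b x3^c x4^d) to coefficients.\<close>

type_synonym 'k poly4 = "(nat \<times> nat \<times> nat \<times> nat) \<Rightarrow>\<^sub>0 'k"

definition X1 :: "'k::comm_ring_1 poly4" where "X1 = Poly_Mapping.single (1,0,0,0) 1"
definition X2 :: "'k::comm_ring_1 poly4" where "X2 = Poly_Mapping.single (0,1,0,0) 1"
definition X3 :: "'k::comm_ring_1 poly4" where "X3 = Poly_Mapping.single (0,0,1,0) 1"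
definition X4 :: "'k::comm_ring_1 poly4" where "X4 = Poly_Mapping.single (0,0,0,1) 1"

definition const4 :: "'k::comm_ring_1 \<Rightarrow> 'k poly4" where
  "const4 c = Poly_Mapping.single (0,0,0,0) c"

definition subst4 :: "'k::comm_ring_1 poly4 \<Rightarrow> 'k poly4 \<Rightarrow> 'k poly4 \<Rightarrow> 'k poly4 \<Rightarrow> 'k poly4 \<Rightarrow> 'k poly4" where
  "subst4 q g1 g2 g3 g4 =
     (\<Sum>m\<in>Poly_Mapping.keys q. case m of (a,b,c,d) \<Rightarrow>
        const4 (Poly_Mapping.lookup q m) * g1 ^ a * g2 ^ b * g3 ^ c * g4 ^ d)"

definition sigma4 :: "'k::comm_ring_1 poly4 \<Rightarrow> 'k poly4" where
  "sigma4 f = subst4 f (X1 + X3) (X2 + X4) X3 X4"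

definition Delta4 :: "'k::comm_ring_1 poly4 \<Rightarrow> 'k poly4" where
  "Delta4 f = sigma4 f - f"

definition algA :: "nat \<Rightarrow> 'k::comm_ring_1 poly4 set" where
  "algA p = range (\<lambda>q. subst4 q (X1 ^ p - X1 * X3 ^ (p - 1)) (X2 ^ p - X2 * X4 ^ (p - 1)) X3 X4)"

definition u4 :: "'k::comm_ring_1 poly4" where "u4 = X1 * X4 - X2 * X3"

definition Mk :: "nat \<Rightarrow> nat \<Rightarrow> 'k::comm_ring_1 poly4 set" where
  "Mk p k = {X1 ^ i * X2 ^ j | i j. i + j = k \<and> i < p \<and> j < p}"

definition Kn :: "nat \<Rightarrow> 'k::comm_ring_1 poly4 set" where
  "Kn n = {f. (Delta4 ^^ n) f = 0}"

definition basisS :: "nat \<Rightarrow> nat \<Rightarrow> 'k::comm_ring_1 poly4 set" where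
  "basisS p n =
     (\<Union>k\<in>{0..<n}. Mk p k)
   \<union> (\<Union>k\<in>{1..p-n}. (\<lambda>m. u4 ^ k * m) ` Mk p (n - 1))
   \<union> (\<Union>k\<in>{2*p-n..2*p-2}. (Delta4 ^^ (p - n)) ` Mk p k)"

definition free_basis :: "'a::comm_ring_1 set \<Rightarrow> 'a set \<Rightarrow> 'a set \<Rightarrow> bool" where
  "free_basis A N S \<longleftrightarrow>
     S \<subseteq> N \<and>
     (\<forall>f\<in>N. \<exists>T a. finite T \<and> T \<subseteq> S \<and> (\<forall>s\<in>T. a s \<in> A) \<and> f = (\<Sum>s\<in>T. a s * s)) \<and>
     (\<forall>T a. finite T \<and> T \<subseteq> S \<and> (\<forall>s\<in>T. a s \<in> A) \<and> (\<Sum>s\<in>T. a s * s) = 0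
        \<longrightarrow> (\<forall>s\<in>T. a s = 0))"

end

theory Submission
  imports Defs
begin

text \<open>
  The elements of \<open>S\<close> are indexed by \<open>(i,j)\<close> with \<open>i < p\<close>, \<open>j < n\<close> such that, modulo \<open>x\<^sub>3\<close>, the element
  \<open>s\<^sub>i\<^sub>j\<close> is a nonzero scalar times a power of \<open>x\<^sub>4\<close> times \<open>x\<^sub>1\<^sup>i x\<^sub>2\<^sup>j\<close>, up to \<open>x\<^sub>1\<^sup>i\<close> times terms of lower degree
  in \<open>x\<^sub>2\<close>. As \<open>k[V]\<close> is free over \<open>A\<close> on the \<open>x\<^sub>1\<^sup>i x\<^sub>2\<^sup>j\<close> with \<open>i, j < p\<close>, the set \<open>S\<close> is independent modulo \<open>x\<^sub>3\<close>.
  Hence it is independent, and its span \<open>N\<close> is saturated: \<open>x\<^sub>3 f \<in> N\<close> implies \<open>f \<in> N\<close>.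

  It remains to generate \<open>K\<^sub>n\<close> after inverting \<open>x\<^sub>3\<close>. Let \<open>z\<^sub>r\<close> be the product of the \<open>x\<^sub>1 - l x\<^sub>3\<close> for
  \<open>l < r\<close>, so that \<open>\<Delta> z\<^sub>r = r x\<^sub>3 z\<^sub>r\<^sub>-\<^sub>1\<close>. Since \<open>\<Delta>\<^sup>p\<^sup>-\<^sup>1\<close> maps \<open>z\<^sub>p\<^sub>-\<^sub>1\<close> to a unit times a power of \<open>x\<^sub>3\<close>,
  every \<open>f \<in> K\<^sub>n\<close> lies, up to a power of \<open>x\<^sub>3\<close>, in the image of \<open>\<Delta>\<^sup>p\<^sup>-\<^sup>n\<close>. This image is generated by the
  images of the \<open>x\<^sub>1\<^sup>i x\<^sub>2\<^sup>j\<close> with \<open>i, j < p\<close>. Those with \<open>i + j \<ge> 2p - n\<close> form \<open>D\<close>. The others have degree less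
  than \<open>p\<close> in \<open>x\<^sub>1, x\<^sub>2\<close>, so after multiplication by a power of \<open>x\<^sub>3\<close> they are combinations of the \<open>u\<^sup>b z\<^sub>a\<close> with
  \<open>a + b < p\<close>, where only \<open>a < n\<close> can occur; such elements are generated by \<open>M\<close> and \<open>U\<close>.
\<close>


section \<open>Polynomials in four variables\<close>

lemma poly_mapping_sum_single:
  fixes f :: "'a \<Rightarrow>\<^sub>0 'b::comm_monoid_add"
  shows "f = (\<Sum>m\<in>Poly_Mapping.keys f. Poly_Mapping.single m (Poly_Mapping.lookup f m))"
proof (rule poly_mapping_eqI)
  fix k
  have "Poly_Mapping.lookup (\<Sum>m\<in>Poly_Mapping.keys f. Poly_Mapping.single m (Poly_Mapping.lookup f m)) k
      = (\<Sum>m\<in>Poly_Mapping.keys f. if m = k then Poly_Mapping.lookup f m else 0)"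
    unfolding lookup_sum by (intro sum.cong) (auto simp: lookup_single)
  also have "\<dots> = Poly_Mapping.lookup f k"
    by (auto simp: sum.delta in_keys_iff)
  finally show "Poly_Mapping.lookup f k
      = Poly_Mapping.lookup (\<Sum>m\<in>Poly_Mapping.keys f. Poly_Mapping.single m (Poly_Mapping.lookup f m)) k"
    by simp
qed

lemma poly_mapping_single_induct [case_names zero single add]:
  fixes f :: "'a \<Rightarrow>\<^sub>0 'b::comm_monoid_add"
  assumes "P 0" and "\<And>m c. P (Poly_Mapping.single m c)" and "\<And>f g. P f \<Longrightarrow> P g \<Longrightarrow> P (f + g)"
  shows "P f"
proof -
  have "P (\<Sum>m\<in>K. Poly_Mapping.single m (Poly_Mapping.lookup f m))" if "finite K" for K
    using that by (induction K rule: finite_induct) (auto intro: assms)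
  then show ?thesis
    using poly_mapping_sum_single[of f] by (metis finite_keys)
qed

lemma X_power:
  "(X1 :: 'k::comm_ring_1 poly4) ^ n = Poly_Mapping.single (n,0,0,0) 1"
  "(X2 :: 'k::comm_ring_1 poly4) ^ n = Poly_Mapping.single (0,n,0,0) 1"
  "(X3 :: 'k::comm_ring_1 poly4) ^ n = Poly_Mapping.single (0,0,n,0) 1"
  "(X4 :: 'k::comm_ring_1 poly4) ^ n = Poly_Mapping.single (0,0,0,n) 1"
  by (induction n; simp add: X1_def X2_def X3_def X4_def mult_single flip: single_one zero_prod_def;
      simp add: zero_prod_def)+

lemma single_eq_monomial:
  "Poly_Mapping.single (a,b,c,d) (k :: 'k::comm_ring_1) = const4 k * X1 ^ a * X2 ^ b * X3 ^ c * X4 ^ d"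
  by (simp add: X_power const4_def mult_single)

lemma const4_hom:
  "const4 0 = (0 :: 'k::comm_ring_1 poly4)" "const4 1 = (1 :: 'k::comm_ring_1 poly4)"
  "const4 (a + b) = (const4 a + const4 b :: 'k::comm_ring_1 poly4)"
  "const4 (a * b) = (const4 a * const4 b :: 'k::comm_ring_1 poly4)"
  "const4 (of_nat n) = (of_nat n :: 'k::comm_ring_1 poly4)"
  by (simp_all add: const4_def mult_single single_add flip: zero_prod_def)

lemma of_nat_poly4_CHAR:
  assumes "CHAR('k::comm_ring_1) = p"
  shows "of_nat p = (0 :: 'k poly4)"
  using assms of_nat_CHAR[where 'a='k] by (metis const4_hom(1,5))

section \<open>Divisibility by \<open>X3\<close> read off from coefficients\<close>

lemma lookup_X3_times:
  "Poly_Mapping.lookup (X3 * f :: 'k::comm_ring_1 poly4) (a,b,c,d)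
    = (if c = 0 then 0 else Poly_Mapping.lookup f (a,b,c-1,d))"
proof (induction f rule: poly_mapping_single_induct)
  case (single m k)
  then show ?case by (cases m) (auto simp: X3_def mult_single lookup_single when_def)
qed (auto simp: distrib_left lookup_add)

lemma lookup_X4_times:
  "Poly_Mapping.lookup (X4 * f :: 'k::comm_ring_1 poly4) (a,b,c,Suc d) = Poly_Mapping.lookup f (a,b,c,d)"
proof (induction f rule: poly_mapping_single_induct)
  case (single m k)
  then show ?case by (cases m) (auto simp: X4_def mult_single lookup_single when_def)
qed (auto simp: distrib_left lookup_add)

lemma X3_dvd_iff:
  "X3 dvd (f :: 'k::comm_ring_1 poly4) \<longleftrightarrow> (\<forall>a b d. Poly_Mapping.lookup f (a,b,0,d) = 0)"
proof
  assume "X3 dvd f"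
  then show "\<forall>a b d. Poly_Mapping.lookup f (a,b,0,d) = 0"
    by (auto simp: dvd_def lookup_X3_times)
next
  assume *: "\<forall>a b d. Poly_Mapping.lookup f (a,b,0,d) = 0"
  have "X3 dvd Poly_Mapping.single m (Poly_Mapping.lookup f m)" if "m \<in> Poly_Mapping.keys f" for m
  proof -
    obtain a b c d where m: "m = (a,b,c,d)" by (cases m)
    with that * have "c \<noteq> 0" by (metis in_keys_iff)
    then show ?thesis
      unfolding m single_eq_monomial by (simp add: dvd_mult dvd_mult2 dvd_power)
  qed
  then show "X3 dvd f"
    by (subst poly_mapping_sum_single) (auto intro: dvd_sum)
qed

lemma X3_times_eq_0D:
  assumes "X3 * f = (0 :: 'k::comm_ring_1 poly4)"
  shows "f = 0"
proof (rule poly_mapping_eqI)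
  fix m :: "nat \<times> nat \<times> nat \<times> nat"
  obtain a b c d where m: "m = (a,b,c,d)" by (cases m)
  show "Poly_Mapping.lookup f m = Poly_Mapping.lookup 0 m"
    using lookup_X3_times[of f a b "Suc c" d] assms by (simp add: m)
qed

lemma X3_times_cancel: "X3 * f = X3 * g \<longleftrightarrow> f = (g :: 'k::comm_ring_1 poly4)"
  using X3_times_eq_0D[of "f - g"] by (auto simp: right_diff_distrib)

lemma X3_power_times_cancel: "X3 ^ m * f = X3 ^ m * g \<longleftrightarrow> f = (g :: 'k::comm_ring_1 poly4)"
  by (induction m) (auto simp: X3_times_cancel mult.assoc)

lemma X3_power_times_eq_0D: "X3 ^ m * f = (0 :: 'k::comm_ring_1 poly4) \<Longrightarrow> f = 0"
  using X3_power_times_cancel[of m f 0] by simp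

text \<open>A coefficient with \<open>X3\<close>-exponent \<open>c\<close> disappears as soon as
  \<open>X3 ^ Suc c\<close> divides \<open>f\<close>. This ends the descent that turns independence
  modulo \<open>X3\<close> into independence.\<close>

lemma X3_power_dvd_all_imp_0:
  assumes "\<And>m. X3 ^ m dvd (f :: 'k::comm_ring_1 poly4)"
  shows "f = 0"
proof (rule poly_mapping_eqI)
  fix k :: "nat \<times> nat \<times> nat \<times> nat"
  obtain a b c d where k: "k = (a,b,c,d)" by (cases k)
  have *: "Poly_Mapping.lookup (X3 ^ m * g :: 'k poly4) (a,b,c,d) = 0" if "c < m" for m g c
    using that by (induction m arbitrary: c) (auto simp: lookup_X3_times mult.assoc)
  obtain g where "f = X3 ^ Suc c * g" using assms[of "Suc c"] by (auto simp: dvd_def)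
  then show "Poly_Mapping.lookup f k = Poly_Mapping.lookup 0 k"
    using *[of c "Suc c" g] by (simp add: k)
qed

text \<open>\<open>X4\<close> is a nonzerodivisor modulo \<open>X3\<close>, which allows leading
  coefficients that are units only up to a power of \<open>X4\<close>.\<close>

lemma X3_dvd_X4_power_timesD:
  assumes "X3 dvd X4 ^ e * (f :: 'k::comm_ring_1 poly4)"
  shows "X3 dvd f"
  using assms
proof (induction e)
  case (Suc e)
  have "X3 dvd X4 * (X4 ^ e * f)" using Suc.prems by (simp add: mult.assoc)
  then have "X3 dvd X4 ^ e * f"
    unfolding X3_dvd_iff using lookup_X4_times by metis
  then show ?case by (rule Suc.IH)
qed simp

lemma const4_times_cancel:
  assumes "c \<noteq> (0 :: 'k::field)"
  shows "const4 (inverse c) * (const4 c * f) = f"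
  using assms by (simp add: mult.assoc[symmetric] const4_hom(2) flip: const4_hom(4))

section \<open>Linear extension and substitution\<close>

text \<open>Besides substitutions this covers \<open>Phi\<close> and \<open>spread\<close>, which
  are linear but not multiplicative.\<close>

definition linext :: "(nat \<times> nat \<times> nat \<times> nat \<Rightarrow> 'k poly4) \<Rightarrow> 'k::comm_ring_1 poly4 \<Rightarrow> 'k poly4" where
  "linext \<phi> q = (\<Sum>m\<in>Poly_Mapping.keys q. const4 (Poly_Mapping.lookup q m) * \<phi> m)"

lemma linext_0 [simp]: "linext \<phi> 0 = 0"
  by (simp add: linext_def)

lemma linext_add: "linext \<phi> (f + g) = linext \<phi> f + linext \<phi> g"
  unfolding linext_def
  by (rule setsum_keys_plus_distrib) (simp_all add: const4_hom distrib_right)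

lemma linext_single: "linext \<phi> (Poly_Mapping.single m c) = const4 c * \<phi> m"
  by (cases "c = 0") (simp_all add: linext_def const4_hom)

lemma linext_diff: "linext \<phi> (f - g) = linext \<phi> f - linext \<phi> g"
  using linext_add[of \<phi> "f - g" g] by simp

lemma linext_sum: "linext \<phi> (\<Sum>i\<in>I. f i) = (\<Sum>i\<in>I. linext \<phi> (f i))"
  by (induction I rule: infinite_finite_induct) (simp_all add: linext_add)

lemma subst4_linext:
  "subst4 q g1 g2 g3 g4 = linext (\<lambda>(a,b,c,d). g1 ^ a * g2 ^ b * g3 ^ c * g4 ^ d) q"
  unfolding subst4_def linext_def by (intro sum.cong) (auto simp: mult.assoc)

lemma subst4_add:
  "subst4 (f + g) g1 g2 g3 g4 = subst4 f g1 g2 g3 g4 + subst4 g g1 g2 g3 g4"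
  by (simp add: subst4_linext linext_add)

lemma subst4_0 [simp]: "subst4 0 g1 g2 g3 g4 = 0"
  by (simp add: subst4_linext)

lemma subst4_single:
  "subst4 (Poly_Mapping.single (a,b,c,d) k) g1 g2 g3 g4 = const4 k * g1 ^ a * g2 ^ b * g3 ^ c * g4 ^ d"
  by (simp add: subst4_linext linext_single mult.assoc)

lemma subst4_mult:
  "subst4 (f * g) g1 g2 g3 g4 = subst4 f g1 g2 g3 g4 * subst4 g g1 g2 g3 g4"
proof (induction f rule: poly_mapping_single_induct)
  case (single m k)
  obtain a b c d where m: "m = (a,b,c,d)" by (cases m)
  show ?case
  proof (induction g rule: poly_mapping_single_induct)
    case (single m' k')
    obtain a' b' c' d' where m': "m' = (a',b',c',d')" by (cases m')
    show ?case
      unfolding m m' by (simp add: mult_single subst4_single power_add const4_hom mult_ac)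
  qed (simp_all add: distrib_left subst4_add)
qed (simp_all add: distrib_right subst4_add)

lemma subst4_const [simp]: "subst4 (const4 c) g1 g2 g3 g4 = const4 c"
  by (simp add: const4_def subst4_single)

lemma subst4_1 [simp]: "subst4 1 g1 g2 g3 g4 = 1"
  using subst4_const[of 1] by (simp add: const4_hom)

lemma subst4_diff:
  "subst4 (f - g) g1 g2 g3 g4 = subst4 f g1 g2 g3 g4 - subst4 g g1 g2 g3 g4"
  by (simp add: subst4_linext linext_diff)

lemma subst4_X [simp]:
  "subst4 X1 g1 g2 g3 g4 = g1" "subst4 X2 g1 g2 g3 g4 = g2"
  "subst4 X3 g1 g2 g3 g4 = g3" "subst4 X4 g1 g2 g3 g4 = g4"
  by (simp_all add: X1_def X2_def X3_def X4_def subst4_single const4_hom)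

lemma subst4_power: "subst4 (f ^ n) g1 g2 g3 g4 = subst4 f g1 g2 g3 g4 ^ n"
  by (induction n) (simp_all add: subst4_mult)

section \<open>Freeness over A of the polynomial ring\<close>

text \<open>Only the exponents of \<open>X1\<close> and \<open>X2\<close> count. The bound is strict
  so that \<open>low 0\<close> leaves just the zero polynomial, where inductions on the degree
  start.\<close>

definition low :: "nat \<Rightarrow> 'k::comm_ring_1 poly4 \<Rightarrow> bool" where
  "low d f \<longleftrightarrow> (\<forall>(a,b,_)\<in>Poly_Mapping.keys f. a + b < d)"

definition lead :: "nat \<Rightarrow> 'k::comm_ring_1 poly4 \<Rightarrow> 'k poly4 \<Rightarrow> bool" where
  "lead d f g \<longleftrightarrow> low d (f - g) \<and> low (Suc d) g"

lemma low_mono: "low d f \<Longrightarrow> d \<le> e \<Longrightarrow> low e f"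
  by (fastforce simp: low_def)

lemma low_0 [simp]: "low d 0"
  by (simp add: low_def)

lemma low_zero_iff: "low 0 f \<longleftrightarrow> f = 0"
  unfolding low_def using keys_eq_empty[of f] by (auto simp del: keys_eq_empty)

lemma low_add: "low d f \<Longrightarrow> low d g \<Longrightarrow> low d (f + g)"
  unfolding low_def using Poly_Mapping.keys_add[of f g] by fast

lemma low_minus: "low d f \<Longrightarrow> low d (- f)"
  unfolding low_def by (simp add: in_keys_iff split_beta)

lemma low_sum: "(\<And>i. i \<in> I \<Longrightarrow> low d (f i)) \<Longrightarrow> low d (sum f I)"
  by (induction I rule: infinite_finite_induct) (auto intro: low_add)

lemma low_mult:
  assumes "low (Suc d) f" and "low e g"
  shows "low (d + e) (f * g)"
  unfolding low_def
proof
  fix m assume "m \<in> Poly_Mapping.keys (f * g)"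
  then obtain k l where m: "m = k + l" "k \<in> Poly_Mapping.keys f" "l \<in> Poly_Mapping.keys g"
    using Poly_Mapping.keys_mult[of f g] by blast
  with assms show "case m of (a,b,_) \<Rightarrow> a + b < d + e"
    unfolding low_def by (cases k; cases l) fastforce
qed

lemma low_monomial:
  "a + b < e \<Longrightarrow> low e (Poly_Mapping.single (a,b,c,d) k)"
  by (auto simp: low_def split: if_splits)

lemma lead_low: "lead d f g \<Longrightarrow> low (Suc d) f"
  unfolding lead_def using low_add[of "Suc d" "f - g" g] low_mono[of d "f - g" "Suc d"] by simp

lemma lead_refl: "low (Suc d) f \<Longrightarrow> lead d f f"
  by (simp add: lead_def)

lemma lead_mult:
  assumes "lead d f f'" and "lead e g g'"
  shows "lead (d + e) (f * g) (f' * g')"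
proof -
  have "f * g - f' * g' = f * (g - g') + g' * (f - f')" by (simp add: algebra_simps)
  moreover have "low (d + e) (f * (g - g'))"
    using assms lead_low low_mult unfolding lead_def by blast
  moreover have "low (e + d) (g' * (f - f'))"
    using assms low_mult unfolding lead_def by blast
  moreover have "low (Suc (d + e)) (f' * g')"
    using assms low_mult[of d f' "Suc e" g'] unfolding lead_def by simp
  ultimately show ?thesis
    unfolding lead_def by (simp add: low_add add.commute)
qed

lemma lead_power: "lead d f g \<Longrightarrow> lead (d * n) (f ^ n) (g ^ n)"
proof (induction n)
  case 0
  show ?case
    using low_monomial[of 0 0 1 0 0 "1::'a"] by (simp add: lead_def flip: zero_prod_def)
next
  case (Suc n)
  then show ?case using lead_mult[of d f g] by simp
qed

section \<open>The norms of \<open>X1\<close> and \<open>X2\<close> and the linear bijection they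
  induce\<close>

abbreviation N1 :: "nat \<Rightarrow> 'k::comm_ring_1 poly4" where
  "N1 p \<equiv> X1 ^ p - X1 * X3 ^ (p - 1)"

abbreviation N2 :: "nat \<Rightarrow> 'k::comm_ring_1 poly4" where
  "N2 p \<equiv> X2 ^ p - X2 * X4 ^ (p - 1)"

lemma lead_N:
  assumes "1 < p"
  shows "lead p (N1 p) (X1 ^ p)" and "lead p (N2 p) (X2 ^ p)"
proof -
  have "X1 * X3 ^ (p - 1) = Poly_Mapping.single (1,0,p-1,0) (1::'a)"
    "X2 * X4 ^ (p - 1) = Poly_Mapping.single (0,1,0,p-1) (1::'b)"
    by (simp_all add: X_power X1_def X2_def mult_single)
  then have "low p (X1 * X3 ^ (p - 1) :: 'a poly4)" "low p (X2 * X4 ^ (p - 1) :: 'b poly4)"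
    using assms by (simp_all add: low_monomial)
  then show "lead p (N1 p) (X1 ^ p :: 'a poly4)" "lead p (N2 p) (X2 ^ p :: 'b poly4)"
    using assms low_minus unfolding lead_def by (auto simp: X_power low_monomial)
qed

text \<open>Unlike a substitution, this is only linear: it keeps the exponents modulo \<open>p\<close> and replaces
  \<open>x\<^sub>i\<^sup>p\<close> by the norm of \<open>x\<^sub>i\<close>. As it changes only terms of lower degree in \<open>x\<^sub>1, x\<^sub>2\<close>, it is bijective.\<close>

definition Phi :: "nat \<Rightarrow> 'k::comm_ring_1 poly4 \<Rightarrow> 'k poly4" where
  "Phi p = linext (\<lambda>(a,b,c,d).
     N1 p ^ (a div p) * X1 ^ (a mod p) * (N2 p ^ (b div p) * X2 ^ (b mod p)) * (X3 ^ c * X4 ^ d))"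

text \<open>The norms have leading terms \<open>X1 ^ p\<close> and \<open>X2 ^ p\<close>, so by
  division with remainder of the exponents \<open>Phi\<close> fixes each monomial up to lower
  degree.\<close>

lemma low_Phi_diff:
  assumes "1 < p" and "low (Suc e) f"
  shows "low e (Phi p f - f)"
proof -
  let ?\<phi> = "\<lambda>(a,b,c,d).
     N1 p ^ (a div p) * X1 ^ (a mod p) * (N2 p ^ (b div p) * X2 ^ (b mod p)) * (X3 ^ c * X4 ^ d) :: 'a poly4"
  have "low e (const4 (Poly_Mapping.lookup f m) * ?\<phi> m - Poly_Mapping.single m (Poly_Mapping.lookup f m))"
    if "m \<in> Poly_Mapping.keys f" for m
  proof -
    obtain a b c d where m: "m = (a,b,c,d)" by (cases m)
    have "lead (p * (a div p) + a mod p + (p * (b div p) + b mod p) + 0)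
       (N1 p ^ (a div p) * X1 ^ (a mod p) * (N2 p ^ (b div p) * X2 ^ (b mod p)) * (X3 ^ c * X4 ^ d) :: 'a poly4)
       ((X1 ^ p) ^ (a div p) * X1 ^ (a mod p) * ((X2 ^ p) ^ (b div p) * X2 ^ (b mod p)) * (X3 ^ c * X4 ^ d))"
      by (intro lead_mult lead_power lead_N assms(1) lead_refl)
        (simp_all add: X_power mult_single low_monomial)
    then have *: "lead (a + b) (?\<phi> m) (X1 ^ a * X2 ^ b * X3 ^ c * X4 ^ d)"
      unfolding m by (simp add: power_mult[symmetric] power_add[symmetric] mult.assoc)
    have "a + b \<le> e" using assms(2) that by (auto simp: low_def m)
    with * have "low e (?\<phi> m - X1 ^ a * X2 ^ b * X3 ^ c * X4 ^ d)"
      unfolding lead_def using low_mono by blast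
    from low_mult[OF low_monomial this, of 0 0 0 0 0 "Poly_Mapping.lookup f m"]
    show ?thesis unfolding m single_eq_monomial const4_def[symmetric]
      by (simp add: right_diff_distrib mult.assoc)
  qed
  then have "low e (\<Sum>m\<in>Poly_Mapping.keys f.
      const4 (Poly_Mapping.lookup f m) * ?\<phi> m - Poly_Mapping.single m (Poly_Mapping.lookup f m))"
    by (rule low_sum)
  then show ?thesis
    unfolding Phi_def linext_def sum_subtractf poly_mapping_sum_single[symmetric] .
qed

lemma exists_low: "\<exists>d. low d (f :: 'k::comm_ring_1 poly4)"
proof (induction f rule: poly_mapping_single_induct)
  case (single m c)
  then show ?case using low_monomial by (cases m) blast
next
  case (add f g)
  then obtain d e where "low d f" "low e g" by blast
  then have "low (max d e) (f + g)"
    using low_mono[of d f "max d e"] low_mono[of e g "max d e"] low_add by simp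
  then show ?case by blast
qed auto

text \<open>Here \<open>f\<close> equals \<open>f - Phi p f\<close>, whose degree is smaller than
  that of \<open>f\<close>; descend on the degree.\<close>

lemma Phi_eq_0D:
  assumes "1 < p" and "Phi p f = 0"
  shows "f = 0"
proof -
  have "f = 0" if "low d f" for d
    using that
  proof (induction d)
    case (Suc d)
    then show ?case
      using low_Phi_diff[of p d f] assms low_minus[of d "- f"] by simp
  qed (simp add: low_zero_iff)
  then show ?thesis using exists_low by blast
qed

lemma Phi_surj:
  assumes "1 < p"
  shows "\<exists>g. f = Phi p g"
proof -
  have "\<exists>g. f = Phi p g" if "low d f" for d
    using that
  proof (induction d arbitrary: f)
    case 0
    then show ?case by (intro exI[of _ 0]) (simp add: low_zero_iff Phi_def)
  next
    case (Suc d)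
    then have "low d (Phi p f - f)" using low_Phi_diff assms by blast
    then obtain g where "Phi p f - f = Phi p g" using Suc.IH by blast
    then have "f = Phi p (f - g)" by (simp add: Phi_def linext_diff algebra_simps)
    then show ?case ..
  qed
  then show ?thesis using exists_low by blast
qed

lemma Phi_X3: "Phi p (X3 * f) = X3 * Phi p f"
proof (induction f rule: poly_mapping_single_induct)
  case (single m c)
  obtain a b e d where m: "m = (a,b,e,d)" by (cases m)
  have "X3 * Poly_Mapping.single m c = Poly_Mapping.single (a,b,Suc e,d) c"
    by (simp add: m X3_def mult_single)
  then show ?case
    by (simp add: m Phi_def linext_single mult_ac)
qed (simp_all add: distrib_left Phi_def linext_add)

text \<open>\<open>Phi\<close> is bijective and commutes with multiplication by \<open>X3\<close>,
  so the quotient by \<open>X3\<close> can be pulled back.\<close>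

lemma X3_dvd_PhiD:
  assumes "1 < p" and "X3 dvd Phi p f"
  shows "X3 dvd f"
proof -
  obtain g where g: "Phi p f = X3 * g" using assms(2) by (auto simp: dvd_def)
  obtain h where "g = Phi p h" using Phi_surj assms(1) by blast
  with g have "Phi p (f - X3 * h) = 0" by (simp add: Phi_X3[symmetric]) (simp add: Phi_def linext_diff)
  then have "f = X3 * h" using Phi_eq_0D assms(1) by fastforce
  then show ?thesis by simp
qed

text \<open>The exponents of the image lie in the residue classes of \<open>i\<close> and
  \<open>j\<close> modulo \<open>p\<close>. Distinct pairs below \<open>p\<close> thus occupy
  disjoint sets of monomials, and \<open>Phi\<close> maps the image to one term of an
  \<open>algA p\<close>-combination of monomials.\<close>

definition spread :: "nat \<Rightarrow> nat \<Rightarrow> nat \<Rightarrow> 'k::comm_ring_1 poly4 \<Rightarrow> 'k poly4" where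
  "spread p i j = linext (\<lambda>(a,b,c,d). Poly_Mapping.single (p * a + i, p * b + j, c, d) 1)"

lemma spread_single:
  "spread p i j (Poly_Mapping.single (a,b,c,d) k) = Poly_Mapping.single (p * a + i, p * b + j, c, d) k"
  by (simp add: spread_def linext_single const4_def mult_single)

lemma Phi_spread:
  assumes "i < p" and "j < p"
  shows "Phi p (spread p i j q) = X1 ^ i * X2 ^ j * subst4 q (N1 p) (N2 p) X3 X4"
proof (induction q rule: poly_mapping_single_induct)
  case (single m k)
  obtain a b c d where m: "m = (a,b,c,d)" by (cases m)
  show ?case
    unfolding m spread_single using assms
    by (simp add: Phi_def linext_single subst4_single mult_ac)
qed (simp_all add: spread_def Phi_def linext_add subst4_add distrib_left)

lemma lookup_spread:
  assumes "i < p" and "j < p" and "i' < p" and "j' < p"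
  shows "Poly_Mapping.lookup (spread p i' j' q) (p * a + i, p * b + j, c, d)
    = (if i = i' \<and> j = j' then Poly_Mapping.lookup q (a,b,c,d) else 0)"
proof (induction q rule: poly_mapping_single_induct)
  case (single m k)
  obtain a' b' c' d' where m: "m = (a',b',c',d')" by (cases m)
  have "p * x + r = p * y + s \<longleftrightarrow> x = y \<and> r = s" if "r < p" "s < p" for x y r s
  proof
    assume "p * x + r = p * y + s"
    then have "(p * x + r) div p = (p * y + s) div p" "(p * x + r) mod p = (p * y + s) mod p" by simp_all
    then show "x = y \<and> r = s" using that by simp
  qed simp
  then show ?case
    unfolding m spread_single using assms by (auto simp: lookup_single when_def)
qed (simp_all add: spread_def linext_add lookup_add)

text \<open>Freeness modulo \<open>X3\<close>: the sum is the \<open>Phi\<close>-image of a sum of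
  spreads, which \<open>X3\<close> must then divide too. Reading one residue class of exponents
  shows that \<open>X3\<close> divides the polynomial behind \<open>a i j\<close>, so the quotient
  stays in \<open>algA p\<close>.\<close>

lemma X3_dvd_monomial_sumD:
  assumes "1 < p" and "\<And>i j. i < p \<Longrightarrow> j < p \<Longrightarrow> a i j \<in> algA p"
    and "X3 dvd (\<Sum>i<p. \<Sum>j<p. a i j * (X1 ^ i * X2 ^ j))" and "i < p" and "j < p"
  shows "\<exists>b\<in>algA p. a i j = X3 * (b :: 'k::comm_ring_1 poly4)"
proof -
  have "\<forall>i j. \<exists>q. i < p \<longrightarrow> j < p \<longrightarrow> a i j = subst4 q (N1 p) (N2 p) X3 X4"
    using assms(2) unfolding algA_def by blast
  then obtain q where q: "\<And>i j. i < p \<Longrightarrow> j < p \<Longrightarrow> a i j = subst4 (q i j) (N1 p) (N2 p) X3 X4"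
    by metis
  define F where "F = (\<Sum>i<p. \<Sum>j<p. spread p i j (q i j))"
  have "Phi p F = (\<Sum>i<p. \<Sum>j<p. Phi p (spread p i j (q i j)))"
    unfolding F_def Phi_def linext_sum ..
  also have "\<dots> = (\<Sum>i<p. \<Sum>j<p. a i j * (X1 ^ i * X2 ^ j))"
    by (intro sum.cong refl) (simp add: Phi_spread q mult.commute)
  finally have "Phi p F = (\<Sum>i<p. \<Sum>j<p. a i j * (X1 ^ i * X2 ^ j))" .
  with assms(1,3) have "X3 dvd F" using X3_dvd_PhiD by metis
  moreover have "Poly_Mapping.lookup F (p * x + i, p * y + j, 0, d) = Poly_Mapping.lookup (q i j) (x,y,0,d)" for x y d
  proof -
    have "Poly_Mapping.lookup F (p * x + i, p * y + j, 0, d)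
        = (\<Sum>i'<p. if i' = i then (\<Sum>j'<p. if j' = j then Poly_Mapping.lookup (q i j) (x,y,0,d) else 0) else 0)"
      unfolding F_def lookup_sum using assms(4,5)
      by (intro sum.cong refl) (auto simp: lookup_spread intro!: sum.cong)
    also have "\<dots> = Poly_Mapping.lookup (q i j) (x,y,0,d)" using assms(4,5) by simp
    finally show ?thesis .
  qed
  ultimately have "X3 dvd q i j" unfolding X3_dvd_iff by metis
  then obtain r where "q i j = X3 * r" by (auto simp: dvd_def)
  then have "a i j = X3 * subst4 r (N1 p) (N2 p) X3 X4" using q assms(4,5) by (simp add: subst4_mult)
  then show ?thesis unfolding algA_def by blast
qed

section \<open>Spans over a subring\<close>

inductive_set hull :: "'a::comm_ring_1 set \<Rightarrow> 'a set \<Rightarrow> 'a set" for A S where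
  zero: "0 \<in> hull A S"
| step: "a \<in> A \<Longrightarrow> s \<in> S \<Longrightarrow> f \<in> hull A S \<Longrightarrow> a * s + f \<in> hull A S"

lemma hull_add:
  assumes "f \<in> hull A S" and "g \<in> hull A S"
  shows "f + g \<in> hull A S"
  using assms by (induction f rule: hull.induct) (auto simp: add.assoc intro: hull.step)

lemma hull_sum: "(\<And>i. i \<in> I \<Longrightarrow> f i \<in> hull A S) \<Longrightarrow> sum f I \<in> hull A S"
  by (induction I rule: infinite_finite_induct) (auto intro: hull_add hull.zero)

lemma hull_mono: "S \<subseteq> S' \<Longrightarrow> hull A S \<subseteq> hull A S'"
proof
  fix f assume "S \<subseteq> S'" "f \<in> hull A S"
  from this(2,1) show "f \<in> hull A S'"
    by (induction f rule: hull.induct) (auto intro: hull.intros)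
qed

locale unital_subring =
  fixes A :: "'a::comm_ring_1 set"
  assumes one_mem: "1 \<in> A"
    and diff_mem: "a \<in> A \<Longrightarrow> b \<in> A \<Longrightarrow> a - b \<in> A"
    and mult_mem: "a \<in> A \<Longrightarrow> b \<in> A \<Longrightarrow> a * b \<in> A"
begin

lemma zero_mem: "0 \<in> A"
  using diff_mem[OF one_mem one_mem] by simp

lemma uminus_mem: "a \<in> A \<Longrightarrow> - a \<in> A"
  using diff_mem[OF zero_mem] by simp

lemma add_mem: "a \<in> A \<Longrightarrow> b \<in> A \<Longrightarrow> a + b \<in> A"
  using diff_mem[OF _ uminus_mem, of a b] by simp

lemma power_mem: "a \<in> A \<Longrightarrow> a ^ n \<in> A"
  by (induction n) (auto intro: one_mem mult_mem)

lemma of_nat_mem: "of_nat n \<in> A"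
  by (induction n) (auto intro: zero_mem one_mem add_mem)

lemma hull_base: "s \<in> S \<Longrightarrow> s \<in> hull A S"
  using hull.step[OF one_mem _ hull.zero] by fastforce

lemma hull_scale:
  assumes "f \<in> hull A S" and "a \<in> A"
  shows "a * f \<in> hull A S"
  using assms
  by (induction f rule: hull.induct)
    (auto simp: distrib_left mult.assoc[symmetric] intro: hull.intros mult_mem)

lemma hull_diff: "f \<in> hull A S \<Longrightarrow> g \<in> hull A S \<Longrightarrow> f - g \<in> hull A S"
  using hull_add[of f A S "- g"] hull_scale[OF _ uminus_mem[OF one_mem], of g S] by simp

lemma hull_linear:
  assumes "f \<in> hull A S" and "\<And>s. s \<in> S \<Longrightarrow> L s \<in> hull A S'"
    and "L 0 = 0" and "\<And>a s f. a \<in> A \<Longrightarrow> L (a * s + f) = a * L s + L f"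
  shows "L f \<in> hull A S'"
  using assms(1) by (induction f rule: hull.induct) (simp_all add: assms hull.zero hull_add hull_scale)

lemma hull_times:
  assumes "f \<in> hull A S" and "\<And>s. s \<in> S \<Longrightarrow> g * s \<in> hull A S'"
  shows "g * f \<in> hull A S'"
  by (rule hull_linear[where L = "\<lambda>f. g * f", OF assms]) (simp_all add: algebra_simps)

lemma hull_subset: "f \<in> hull A S \<Longrightarrow> S \<subseteq> hull A S' \<Longrightarrow> f \<in> hull A S'"
  using hull_linear[where L = "\<lambda>f. f"] by blast

text \<open>The family may repeat elements; each step of the span is charged to one chosen index.
  Membership in \<open>A\<close> is granted at all indices, inside \<open>I\<close> or not.\<close>

lemma hull_family:
  assumes "f \<in> hull A (s ` I)" and "finite I"
  obtains a where "\<And>i. a i \<in> A" and "f = (\<Sum>i\<in>I. a i * s i)"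
proof -
  have "\<exists>a. (\<forall>i. a i \<in> A) \<and> f = (\<Sum>i\<in>I. a i * s i)"
    using assms(1)
  proof (induction f rule: hull.induct)
    case zero
    then show ?case by (intro exI[of _ "\<lambda>_. 0"]) (simp add: zero_mem)
  next
    case (step b t f)
    then obtain a j where a: "\<forall>i. a i \<in> A" "f = (\<Sum>i\<in>I. a i * s i)" "j \<in> I" "t = s j" by blast
    have "b * t + f = (\<Sum>i\<in>I. (if i = j then b * s i else 0) + a i * s i)"
      using a(3,4) assms(2) by (simp add: sum.distrib a(2))
    also have "\<dots> = (\<Sum>i\<in>I. (a i + (if i = j then b else 0)) * s i)"
      by (intro sum.cong refl) (simp add: algebra_simps)
    finally show ?case
      using a(1) step(1) by (intro exI[of _ "\<lambda>i. a i + (if i = j then b else 0)"]) (auto intro: add_mem zero_mem)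
  qed
  then show thesis using that by blast
qed

end

section \<open>The group action\<close>

lemma sigma4_hom [simp]:
  "sigma4 0 = 0" "sigma4 1 = 1" "sigma4 (const4 c) = const4 c"
  "sigma4 (f + g) = sigma4 f + sigma4 g" "sigma4 (f - g) = sigma4 f - sigma4 g"
  "sigma4 (f * g) = sigma4 f * sigma4 g" "sigma4 (f ^ n) = sigma4 f ^ n"
  "sigma4 X1 = X1 + X3" "sigma4 X2 = X2 + X4" "sigma4 X3 = X3" "sigma4 X4 = X4"
  by (simp_all add: sigma4_def subst4_add subst4_diff subst4_mult subst4_power)

lemma sigma4_of_nat [simp]: "sigma4 (of_nat n) = of_nat n"
  by (simp flip: const4_hom(5))

lemma sigma4_u4 [simp]: "sigma4 u4 = u4"
  by (simp add: u4_def algebra_simps)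

lemma Delta4_0 [simp]: "Delta4 0 = 0"
  by (simp add: Delta4_def)

lemma Delta4_diff: "Delta4 (f - g) = Delta4 f - Delta4 g"
  by (simp add: Delta4_def)

lemma Delta4_times: "sigma4 a = a \<Longrightarrow> Delta4 (a * f) = a * Delta4 f"
  by (simp add: Delta4_def right_diff_distrib)

lemma Delta4_X1_times: "Delta4 (X1 * f) = X3 * f + (X1 + X3) * Delta4 f"
  by (simp add: Delta4_def algebra_simps)

lemma Delta4_X2_times: "Delta4 (X2 * f) = X4 * f + (X2 + X4) * Delta4 f"
  by (simp add: Delta4_def algebra_simps)

lemma Delta4_pow_add: "(Delta4 ^^ n) (f + g) = (Delta4 ^^ n) f + (Delta4 ^^ n) g"
  by (induction n) (simp_all add: Delta4_def)

lemma Delta4_pow_0 [simp]: "(Delta4 ^^ n) 0 = 0"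
  by (induction n) simp_all

lemma Delta4_pow_diff: "(Delta4 ^^ n) (f - g) = (Delta4 ^^ n) f - (Delta4 ^^ n) g"
  by (induction n) (simp_all add: Delta4_diff)

lemma Delta4_pow_times:
  assumes "sigma4 a = a"
  shows "(Delta4 ^^ n) (a * f) = a * (Delta4 ^^ n) f"
  by (induction n) (simp_all add: Delta4_times assms)

lemma Delta4_pow_pow: "(Delta4 ^^ m) ((Delta4 ^^ n) f) = (Delta4 ^^ (m + n)) f"
  by (simp add: funpow_add)

lemma unital_subring_algA: "unital_subring (algA p :: 'k::comm_ring_1 poly4 set)"
proof
  show "(1 :: 'k poly4) \<in> algA p"
    unfolding algA_def by (rule range_eqI[of _ _ 1]) simp
next
  fix a b :: "'k poly4"
  assume "a \<in> algA p" "b \<in> algA p"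
  then obtain q r where "a = subst4 q (N1 p) (N2 p) X3 X4" "b = subst4 r (N1 p) (N2 p) X3 X4"
    unfolding algA_def by blast
  then show "a - b \<in> algA p" "a * b \<in> algA p"
    unfolding algA_def by (auto simp flip: subst4_diff subst4_mult)
qed

interpretation algA: unital_subring "algA p :: 'k::comm_ring_1 poly4 set" for p
  by (rule unital_subring_algA)

lemma algA_generators:
  "const4 c \<in> algA p" "X3 \<in> algA p" "X4 \<in> algA p" "N1 p \<in> algA p" "N2 p \<in> algA p"
  unfolding algA_def
  by (rule range_eqI[of _ _ "const4 c"] range_eqI[of _ _ X3] range_eqI[of _ _ X4]
      range_eqI[of _ _ X1] range_eqI[of _ _ X2], simp)+

lemmas algA_intros = algA_generators algA.one_mem algA.add_mem algA.diff_mem algA.mult_mem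
  algA.power_mem algA.of_nat_mem algA.uminus_mem

lemma sigma4_subst4:
  "sigma4 (subst4 q g1 g2 g3 g4) = subst4 q (sigma4 g1) (sigma4 g2) (sigma4 g3) (sigma4 g4)"
proof (induction q rule: poly_mapping_single_induct)
  case (single m c)
  then show ?case by (cases m) (simp add: subst4_single)
qed (simp_all add: subst4_add)

lemma poly4_power_CHAR_add:
  assumes "prime p" and "CHAR('k::comm_ring_1) = p"
  shows "(f + g :: 'k poly4) ^ p = f ^ p + g ^ p"
proof -
  have "CHAR('k poly4) dvd p"
    using of_nat_poly4_CHAR[OF assms(2)] of_nat_eq_0_iff_char_dvd by blast
  moreover have "CHAR('k poly4) \<noteq> 1"
    by (metis of_nat_1 of_nat_CHAR zero_neq_one)
  ultimately have "CHAR('k poly4) = p" using assms(1) by (metis prime_nat_iff)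
  then show ?thesis using freshmans_dream[where 'a = "'k poly4" and ?x = f and ?y = g] assms(1) by simp
qed

text \<open>In characteristic \<open>p\<close> the power \<open>(X1 + X3) ^ p\<close> only gains
  \<open>X3 ^ p\<close>, which cancels against the gain of \<open>X1 * X3 ^ (p - 1)\<close>;
  likewise for \<open>X2\<close>. Hence \<open>Delta4\<close> is linear over
  \<open>algA p\<close>.\<close>

lemma sigma4_algA:
  assumes "prime p" and "CHAR('k::comm_ring_1) = p" and "a \<in> algA p"
  shows "sigma4 a = (a :: 'k poly4)"
proof -
  have p: "p = Suc (p - 1)" using assms(1) prime_gt_0_nat by simp
  have "X3 ^ p = (X3 * X3 ^ (p - 1) :: 'k poly4)" "X4 ^ p = (X4 * X4 ^ (p - 1) :: 'k poly4)"
    using p by (metis power_Suc)+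
  then have "sigma4 (N1 p) = (N1 p :: 'k poly4)" "sigma4 (N2 p) = (N2 p :: 'k poly4)"
    by (simp_all add: poly4_power_CHAR_add[OF assms(1,2)] distrib_right)
  with assms(3) show ?thesis by (auto simp: algA_def sigma4_subst4)
qed

lemma hull_monomials_UNIV:
  assumes "1 < p"
  shows "(f :: 'k::comm_ring_1 poly4) \<in> hull (algA p) ((\<lambda>(i,j). X1 ^ i * X2 ^ j) ` ({..<p} \<times> {..<p}))"
proof -
  obtain g where "f = Phi p g" using Phi_surj assms by blast
  moreover have "const4 c * (N1 p ^ (a div p) * X1 ^ (a mod p) * (N2 p ^ (b div p) * X2 ^ (b mod p)) * (X3 ^ e * X4 ^ d))
    \<in> hull (algA p) ((\<lambda>(i,j). X1 ^ i * X2 ^ j) ` ({..<p} \<times> {..<p}))" for a b e d and c :: 'k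
  proof -
    have "X1 ^ (a mod p) * X2 ^ (b mod p) \<in> (\<lambda>(i,j). X1 ^ i * X2 ^ j :: 'k poly4) ` ({..<p} \<times> {..<p})"
      using assms by (intro image_eqI[of _ _ "(a mod p, b mod p)"]) auto
    then have "const4 c * N1 p ^ (a div p) * N2 p ^ (b div p) * X3 ^ e * X4 ^ d * (X1 ^ (a mod p) * X2 ^ (b mod p))
      \<in> hull (algA p) ((\<lambda>(i,j). X1 ^ i * X2 ^ j) ` ({..<p} \<times> {..<p}))"
      by (intro algA.hull_scale algA.hull_base algA_intros)
    then show ?thesis by (simp add: mult_ac)
  qed
  ultimately show ?thesis
    unfolding Phi_def linext_def by (auto intro!: hull_sum)
qed

lemma hull_Delta4_pow:
  assumes "prime p" and "CHAR('k::comm_ring_1) = p"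
    and "f \<in> hull (algA p) S" and "\<And>s. s \<in> S \<Longrightarrow> (Delta4 ^^ n) s \<in> hull (algA p) S'"
  shows "(Delta4 ^^ n) f \<in> hull (algA p) (S' :: 'k poly4 set)"
  by (rule algA.hull_linear[where L = "Delta4 ^^ n", OF assms(3,4)])
    (simp_all add: Delta4_pow_add Delta4_pow_times sigma4_algA[OF assms(1,2)])

section \<open>Falling factorials\<close>

text \<open>The \<open>z\<close> of the overview: the falling factorial of \<open>X1\<close> with
  step \<open>X3\<close>, adapted to \<open>sigma4\<close> as a shift by \<open>X3\<close>.\<close>

definition ffact4 :: "nat \<Rightarrow> 'k::comm_ring_1 poly4" where
  "ffact4 r = (\<Prod>l<r. X1 - of_nat l * X3)"

lemma ffact4_0 [simp]: "ffact4 0 = 1"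
  by (simp add: ffact4_def)

lemma ffact4_Suc: "ffact4 (Suc r) = ffact4 r * (X1 - of_nat r * X3)"
  by (simp add: ffact4_def)

text \<open>The shift carries every factor to its predecessor; only the first one turns into the new
  factor \<open>X1 + X3\<close>.\<close>

lemma sigma4_ffact4: "sigma4 (ffact4 (Suc r)) = (X1 + X3) * (ffact4 r :: 'k::comm_ring_1 poly4)"
proof (induction r)
  case (Suc r)
  have "sigma4 (ffact4 (Suc (Suc r)) :: 'k poly4) = sigma4 (ffact4 (Suc r)) * (X1 - of_nat r * X3)"
    by (subst ffact4_Suc) (simp add: algebra_simps)
  also have "\<dots> = (X1 + X3) * ffact4 (Suc r)"
    unfolding Suc.IH by (simp only: ffact4_Suc mult.assoc)
  finally show ?case .
qed (simp add: ffact4_Suc)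

lemma Delta4_ffact4: "Delta4 (ffact4 (Suc r)) = of_nat (Suc r) * X3 * ffact4 r"
  unfolding Delta4_def sigma4_ffact4 by (simp add: ffact4_Suc algebra_simps)

text \<open>The scalar is written with the factor \<open>fact k\<close> so that it visibly vanishes
  in characteristic \<open>p\<close> when \<open>k = p\<close>.\<close>

lemma Delta4_pow_ffact4:
  "(Delta4 ^^ k) (ffact4 (k + a)) = of_nat (fact k * ((k + a) choose k)) * X3 ^ k * (ffact4 a :: 'k::comm_ring_1 poly4)"
proof (induction k)
  case (Suc k)
  have "(Delta4 ^^ Suc k) (ffact4 (Suc k + a)) = (Delta4 ^^ k) (of_nat (Suc (k + a)) * X3 * (ffact4 (k + a) :: 'k poly4))"
    by (simp only: funpow_Suc_right o_apply add_Suc Delta4_ffact4)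
  also have "\<dots> = of_nat (Suc (k + a)) * X3 * (Delta4 ^^ k) (ffact4 (k + a))"
    by (rule Delta4_pow_times) simp
  also have "\<dots> = of_nat (Suc (k + a) * (fact k * ((k + a) choose k))) * X3 ^ Suc k * ffact4 a"
    by (simp only: Suc.IH of_nat_mult power_Suc mult_ac)
  also have "Suc (k + a) * (fact k * ((k + a) choose k)) = fact (Suc k) * ((Suc k + a) choose Suc k)"
    using Suc_times_binomial_eq[of "k + a" k] by (simp only: fact_Suc of_nat_id add_Suc mult_ac)
  finally show ?case .
qed simp

lemma Delta4_pow_ffact4_self: "(Delta4 ^^ r) (ffact4 r) = of_nat (fact r) * X3 ^ r"
  using Delta4_pow_ffact4[of r 0] by simp

lemma Delta4_pow_ffact4_eq_0:
  assumes "r < n"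
  shows "(Delta4 ^^ n) (ffact4 r) = 0"
proof -
  obtain d where n: "n = d + Suc r" using assms less_iff_Suc_add by (metis add.commute add_Suc_right)
  have "Delta4 (of_nat (fact r) * X3 ^ r :: 'a poly4) = 0" by (simp add: Delta4_def)
  then have "(Delta4 ^^ d) (Delta4 ((Delta4 ^^ r) (ffact4 r :: 'a poly4))) = 0"
    by (simp add: Delta4_pow_ffact4_self)
  then show ?thesis by (simp add: n funpow_add funpow_swap1)
qed

lemma of_nat_fact_times_eq_0D:
  assumes "prime p" and "CHAR('k::field) = p" and "k < p" and "of_nat (fact k) * f = (0 :: 'k poly4)"
  shows "f = 0"
proof -
  have "(of_nat (fact k) :: 'k) \<noteq> 0"
    using assms of_nat_eq_0_iff_char_dvd[of "fact k", where 'a='k] prime_dvd_fact_iff[of p k] by auto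
  from const4_times_cancel[OF this, of f] assms(4) show ?thesis
    by (simp add: const4_hom(5))
qed

text \<open>The falling factorial of length \<open>p - 1\<close> plays the role of an element of nonzero trace,
  which splits the sequence after inverting \<open>x\<^sub>3\<close>.\<close>

lemma kernel_Delta4_pow_in_image:
  assumes "prime p" and "CHAR('k::field) = p" and "n \<le> p" and "(Delta4 ^^ n) f = (0 :: 'k poly4)"
  shows "\<exists>m g. X3 ^ m * f = (Delta4 ^^ (p - n)) g"
  using assms(3,4)
proof (induction n arbitrary: f)
  case 0
  then show ?case by (intro exI[of _ 0]) simp
next
  case (Suc n)
  let ?c = "of_nat (fact (p - 1)) :: 'k"
  have "p - 1 < p" using assms(1) prime_gt_0_nat by simp
  then have c: "?c \<noteq> 0"
    using assms of_nat_eq_0_iff_char_dvd[of "fact (p - 1)", where 'a='k] prime_dvd_fact_iff[of p "p - 1"] by auto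
  \<comment> \<open>As \<open>(Delta4 ^^ n) f\<close> is invariant, \<open>Delta4 ^^ (p - 1)\<close>
    acts only on the falling factorial and yields \<open>?c * X3 ^ (p - 1)\<close>; the inverse
    constant removes \<open>?c\<close>.\<close>
  define y where "y = const4 (inverse ?c) * ((Delta4 ^^ n) f * ffact4 (p - 1))"
  have inv: "sigma4 ((Delta4 ^^ n) f) = (Delta4 ^^ n) f"
    using Suc.prems(2) by (simp add: Delta4_def[of "(Delta4 ^^ n) f"])
  have "(Delta4 ^^ (p - 1)) y = const4 (inverse ?c) * ((Delta4 ^^ n) f * (const4 ?c * X3 ^ (p - 1)))"
    unfolding y_def
    by (subst Delta4_pow_times, simp, subst Delta4_pow_times, rule inv)
      (simp add: Delta4_pow_ffact4_self const4_hom(5))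
  also have "\<dots> = const4 (inverse ?c) * (const4 ?c * (X3 ^ (p - 1) * (Delta4 ^^ n) f))"
    by (simp only: mult_ac)
  also have "\<dots> = X3 ^ (p - 1) * (Delta4 ^^ n) f" by (rule const4_times_cancel[OF c])
  finally have y: "(Delta4 ^^ (p - 1)) y = X3 ^ (p - 1) * (Delta4 ^^ n) f" .
  \<comment> \<open>The correction is chosen so that \<open>Delta4 ^^ n\<close> already kills
    \<open>f'\<close>. The induction hypothesis gives an image under
    \<open>Delta4 ^^ (p - n)\<close>, which lies in the larger image under
    \<open>Delta4 ^^ (p - Suc n)\<close>.\<close>
  define f' where "f' = X3 ^ (p - 1) * f - (Delta4 ^^ (p - Suc n)) y"
  have "(Delta4 ^^ n) f' = X3 ^ (p - 1) * (Delta4 ^^ n) f - (Delta4 ^^ (n + (p - Suc n))) y"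
    by (simp add: f'_def Delta4_pow_diff Delta4_pow_times Delta4_pow_pow)
  also have "n + (p - Suc n) = p - 1" using Suc.prems(1) by simp
  finally have "(Delta4 ^^ n) f' = 0" using y by simp
  then obtain m h where h: "X3 ^ m * f' = (Delta4 ^^ (p - n)) h"
    using Suc.IH Suc.prems(1) Suc_leD by blast
  have "X3 ^ (m + (p - 1)) * f = X3 ^ m * f' + X3 ^ m * (Delta4 ^^ (p - Suc n)) y"
    by (simp add: f'_def algebra_simps power_add)
  also have "\<dots> = (Delta4 ^^ (p - Suc n)) (Delta4 h) + (Delta4 ^^ (p - Suc n)) (X3 ^ m * y)"
    using Suc.prems(1) unfolding h
    by (simp add: Delta4_pow_times Suc_diff_le funpow_swap1[symmetric] flip: funpow_Suc_right Suc_diff_Suc)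
  finally show ?case unfolding Delta4_pow_add[symmetric] by blast
qed

section \<open>Filtration by the degree in the first two variables\<close>

text \<open>Unlike in \<open>low\<close>, the norms count as scalars here, so the filtration is
  stable under \<open>algA p\<close>.\<close>

abbreviation polys_less :: "nat \<Rightarrow> nat \<Rightarrow> 'k::comm_ring_1 poly4 set" where
  "polys_less p d \<equiv> hull (algA p) {X1 ^ i * X2 ^ j | i j. i + j < d}"

lemma polys_less_mono: "f \<in> polys_less p d \<Longrightarrow> d \<le> e \<Longrightarrow> f \<in> polys_less p e"
  by (erule subsetD[OF hull_mono, rotated]) (blast intro: less_le_trans)

lemma polys_less_base: "i + j < d \<Longrightarrow> X1 ^ i * X2 ^ j \<in> polys_less p d"
  by (intro algA.hull_base) blast

lemma X_times_polys_less:
  assumes "f \<in> polys_less p d"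
  shows "X1 * f \<in> polys_less p (Suc d)" and "X2 * f \<in> (polys_less p (Suc d) :: 'k::comm_ring_1 poly4 set)"
proof -
  have "X1 * (X1 ^ i * X2 ^ j) \<in> (polys_less p (Suc d) :: 'k poly4 set)" if "i + j < d" for i j
    using that polys_less_base[of "Suc i" j "Suc d" p] by (simp add: mult.assoc)
  moreover have "X2 * (X1 ^ i * X2 ^ j) \<in> (polys_less p (Suc d) :: 'k poly4 set)" if "i + j < d" for i j
    using that polys_less_base[of i "Suc j" "Suc d" p] by (simp add: mult.left_commute)
  ultimately show "X1 * f \<in> polys_less p (Suc d)" "X2 * f \<in> polys_less p (Suc d)"
    by (auto intro!: algA.hull_times[OF assms])
qed

text \<open>By the twisted product rule, each difference replaces a factor \<open>X1\<close> or
  \<open>X2\<close> by the scalar \<open>X3\<close> or \<open>X4\<close>.\<close>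

lemma Delta4_monomial: "Delta4 (X1 ^ i * X2 ^ j) \<in> (polys_less p (i + j) :: 'k::comm_ring_1 poly4 set)"
proof (induction i)
  case 0
  show ?case
  proof (induction j)
    case 0
    show ?case by (simp add: Delta4_def hull.zero)
  next
    case (Suc j)
    let ?D = "Delta4 (X2 ^ j) :: 'k poly4"
    have D: "?D \<in> polys_less p j" using Suc by simp
    have "X4 * (X1 ^ 0 * X2 ^ j) \<in> (polys_less p (Suc j) :: 'k poly4 set)"
      by (rule algA.hull_scale[OF polys_less_base]) (simp_all add: algA_intros)
    moreover have "X2 * ?D \<in> polys_less p (Suc j)" by (rule X_times_polys_less[OF D])
    moreover have "X4 * ?D \<in> polys_less p (Suc j)"
      by (rule algA.hull_scale[OF polys_less_mono[OF D]]) (simp_all add: algA_intros)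
    ultimately show ?case
      by (simp add: Delta4_X2_times distrib_right hull_add)
  qed
next
  case (Suc i)
  let ?D = "Delta4 (X1 ^ i * X2 ^ j) :: 'k poly4"
  have "X3 * (X1 ^ i * X2 ^ j) \<in> (polys_less p (Suc (i + j)) :: 'k poly4 set)"
    by (rule algA.hull_scale[OF polys_less_base]) (simp_all add: algA_intros)
  moreover have "X1 * ?D \<in> polys_less p (Suc (i + j))" by (rule X_times_polys_less[OF Suc])
  moreover have "X3 * ?D \<in> polys_less p (Suc (i + j))"
    by (rule algA.hull_scale[OF polys_less_mono[OF Suc]]) (simp_all add: algA_intros)
  ultimately show ?case
    by (simp add: Delta4_X1_times distrib_right hull_add mult.assoc)
qed

lemma Delta4_pow_polys_less:
  assumes "prime p" and "CHAR('k::comm_ring_1) = p" and "f \<in> polys_less p (r + d)"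
  shows "(Delta4 ^^ r) f \<in> (polys_less p d :: 'k poly4 set)"
  using assms(3)
proof (induction r arbitrary: d)
  case (Suc r)
  then have "(Delta4 ^^ r) f \<in> polys_less p (Suc d)" by simp
  then have "(Delta4 ^^ 1) ((Delta4 ^^ r) f) \<in> polys_less p d"
  proof (rule hull_Delta4_pow[OF assms(1,2)])
    fix s :: "'k poly4" assume "s \<in> {X1 ^ i * X2 ^ j | i j. i + j < Suc d}"
    then obtain i j where s: "s = X1 ^ i * X2 ^ j" "i + j \<le> d" by auto
    then show "(Delta4 ^^ 1) s \<in> polys_less p d"
      using polys_less_mono[OF Delta4_monomial] by simp
  qed
  then show ?case by simp
qed simp

lemma hull_empty: "f \<in> hull A {} \<longleftrightarrow> f = 0"
  by (auto elim: hull.cases intro: hull.zero)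

lemma Delta4_pow_monomial_eq_0:
  assumes "prime p" and "CHAR('k::comm_ring_1) = p" and "i + j < n"
  shows "(Delta4 ^^ n) (X1 ^ i * X2 ^ j) = (0 :: 'k poly4)"
proof -
  have "X1 ^ i * X2 ^ j \<in> (polys_less p (n + 0) :: 'k poly4 set)"
    using assms(3) by (intro polys_less_base) simp
  from Delta4_pow_polys_less[OF assms(1,2) this] show ?thesis
    by (simp add: hull_empty)
qed

text \<open>\<open>d\<close> controls the degree in \<open>X1\<close> and \<open>X2\<close>, while
  \<open>n\<close> controls the power of \<open>Delta4\<close> that kills the span, since
  \<open>u4\<close> is invariant.\<close>

abbreviation u_ffacts :: "nat \<Rightarrow> nat \<Rightarrow> nat \<Rightarrow> 'k::comm_ring_1 poly4 set" where
  "u_ffacts p d n \<equiv> hull (algA p) {u4 ^ b * ffact4 a | a b. a + b < d \<and> a < n}"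

lemma u_ffacts_base: "a + b < d \<Longrightarrow> a < n \<Longrightarrow> u4 ^ b * ffact4 a \<in> u_ffacts p d n"
  by (intro algA.hull_base) blast

lemma u_ffacts_mono: "f \<in> u_ffacts p d n \<Longrightarrow> d \<le> e \<Longrightarrow> n \<le> m \<Longrightarrow> f \<in> u_ffacts p e m"
  by (erule subsetD[OF hull_mono, rotated]) (blast intro: less_le_trans)

lemma X1_times_u_ffacts:
  assumes "f \<in> u_ffacts p d d"
  shows "X1 * f \<in> (u_ffacts p (Suc d) (Suc d) :: 'k::comm_ring_1 poly4 set)"
proof -
  have "X1 * (u4 ^ b * ffact4 a) \<in> (u_ffacts p (Suc d) (Suc d) :: 'k poly4 set)" if "a + b < d" for a b
  proof -
    have "X1 * (u4 ^ b * ffact4 a) = u4 ^ b * ffact4 (Suc a) + of_nat a * X3 * (u4 ^ b * ffact4 a :: 'k poly4)"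
      by (simp add: ffact4_Suc algebra_simps)
    also have "\<dots> \<in> u_ffacts p (Suc d) (Suc d)"
      using that by (intro hull_add algA.hull_scale[OF u_ffacts_base] u_ffacts_base algA_intros) auto
    finally show ?thesis .
  qed
  then show ?thesis by (auto intro!: algA.hull_times[OF assms])
qed

text \<open>The relation \<open>X3 * X2 = X4 * X1 - u4\<close> trades \<open>X2\<close> for
  \<open>X1\<close> and \<open>u4\<close> at the cost of one factor \<open>X3\<close>.\<close>

lemma X3_X2_times_u_ffacts:
  assumes "f \<in> u_ffacts p d d"
  shows "X3 * X2 * f \<in> (u_ffacts p (Suc d) (Suc d) :: 'k::comm_ring_1 poly4 set)"
proof -
  have "u4 * (u4 ^ b * ffact4 a) \<in> (u_ffacts p (Suc d) (Suc d) :: 'k poly4 set)" if "a + b < d" for a b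
    using u_ffacts_base[of a "Suc b" "Suc d" "Suc d" p] that by (simp add: mult.assoc)
  then have "u4 * f \<in> u_ffacts p (Suc d) (Suc d)"
    by (auto intro!: algA.hull_times[OF assms])
  moreover have "X4 * (X1 * f) \<in> u_ffacts p (Suc d) (Suc d)"
    by (rule algA.hull_scale[OF X1_times_u_ffacts[OF assms]]) (rule algA_generators)
  ultimately have "X4 * (X1 * f) - u4 * f \<in> u_ffacts p (Suc d) (Suc d)"
    by (rule algA.hull_diff[rotated])
  then show ?thesis by (simp add: u4_def algebra_simps)
qed

lemma X3_power_monomial_in_u_ffacts:
  "X3 ^ j * (X1 ^ i * X2 ^ j) \<in> (u_ffacts p (Suc (i + j)) (Suc (i + j)) :: 'k::comm_ring_1 poly4 set)"
proof (induction i)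
  case 0
  show ?case
  proof (induction j)
    case 0
    have "u4 ^ 0 * ffact4 0 \<in> (u_ffacts p (Suc (0 + 0)) (Suc (0 + 0)) :: 'k poly4 set)"
      by (rule u_ffacts_base) simp_all
    then show ?case by (simp only: power_0 ffact4_0 mult_1_left)
  next
    case (Suc j)
    from X3_X2_times_u_ffacts[OF this] show ?case by (simp add: mult_ac)
  qed
next
  case (Suc i)
  from X1_times_u_ffacts[OF this] show ?case by (simp add: mult_ac)
qed

lemma X3_power_polys_less_in_u_ffacts:
  assumes "f \<in> polys_less p d"
  shows "X3 ^ d * f \<in> (u_ffacts p d d :: 'k::comm_ring_1 poly4 set)"
proof -
  have "X3 ^ d * (X1 ^ i * X2 ^ j) \<in> (u_ffacts p d d :: 'k poly4 set)" if "i + j < d" for i j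
  proof -
    have *: "X3 ^ j * (X1 ^ i * X2 ^ j) \<in> (u_ffacts p d d :: 'k poly4 set)"
      using that by (intro u_ffacts_mono[OF X3_power_monomial_in_u_ffacts]) auto
    have "X3 ^ (d - j) * (X3 ^ j * (X1 ^ i * X2 ^ j)) \<in> (u_ffacts p d d :: 'k poly4 set)"
      by (rule algA.hull_scale[OF *]) (intro algA_intros)
    then show ?thesis using that by (simp add: mult.assoc[symmetric] flip: power_add)
  qed
  then show ?thesis by (auto intro!: algA.hull_times[OF assms])
qed

text \<open>After multiplication by a power of \<open>X3\<close>, it suffices to treat
  \<open>ffact4 a\<close>: for \<open>a < p\<close> it is too short to survive, and otherwise the
  scalar contains \<open>fact p\<close>, which is zero. The power of \<open>X3\<close> is then
  cancelled.\<close>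

lemma Delta4_pow_p_monomial:
  assumes "prime p" and "CHAR('k::comm_ring_1) = p"
  shows "(Delta4 ^^ p) (X1 ^ i * X2 ^ j) = (0 :: 'k poly4)"
proof -
  have "(Delta4 ^^ p) (X3 ^ j * (X1 ^ i * X2 ^ j)) \<in> hull (algA p) ({} :: 'k poly4 set)"
  proof (rule hull_Delta4_pow[OF assms X3_power_monomial_in_u_ffacts])
    fix s :: "'k poly4"
    assume "s \<in> {u4 ^ b * ffact4 a | a b. a + b < Suc (i + j) \<and> a < Suc (i + j)}"
    then obtain a b where s: "s = u4 ^ b * ffact4 a" by blast
    have "(Delta4 ^^ p) (ffact4 a :: 'k poly4) = 0"
    proof (cases "a < p")
      case False
      then obtain c where a: "a = p + c" using le_Suc_ex not_less by blast
      obtain m :: nat where m: "fact p = p * m"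
        using dvd_fact[of p p] prime_gt_0_nat[OF assms(1)] by (auto simp: Suc_le_eq dvd_def)
      have "of_nat (fact p) = (0 :: 'k poly4)"
        unfolding m of_nat_mult of_nat_poly4_CHAR[OF assms(2)] by simp
      then show ?thesis by (simp add: a Delta4_pow_ffact4)
    qed (simp add: Delta4_pow_ffact4_eq_0)
    then show "(Delta4 ^^ p) s \<in> hull (algA p) {}"
      by (simp add: s Delta4_pow_times hull.zero)
  qed
  then have "X3 ^ j * (Delta4 ^^ p) (X1 ^ i * X2 ^ j :: 'k poly4) = 0"
    by (simp add: hull_empty Delta4_pow_times)
  then show ?thesis by (rule X3_power_times_eq_0D)
qed

text \<open>Collects the coefficient of the longest falling factorial. It is a polynomial in
  \<open>u4\<close> over \<open>algA p\<close>, hence invariant where this is applied.\<close>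

lemma u_ffacts_Suc_split:
  assumes "f \<in> u_ffacts p d (Suc r)"
  shows "\<exists>g\<in>hull (algA p) (range (\<lambda>b. u4 ^ b)). f - g * ffact4 r \<in> u_ffacts p d r"
  using assms
proof (induction f rule: hull.induct)
  case zero
  show ?case by (intro bexI[of _ 0]) (simp_all add: hull.zero)
next
  case (step c s f)
  then obtain g where g: "g \<in> hull (algA p) (range (\<lambda>b. u4 ^ b))" "f - g * ffact4 r \<in> u_ffacts p d r"
    by blast
  obtain a b where s: "s = u4 ^ b * ffact4 a" "a + b < d" "a < Suc r" using step.hyps(2) by blast
  show ?case
  proof (cases "a = r")
    case True
    have "c * u4 ^ b + g \<in> hull (algA p) (range (\<lambda>b. u4 ^ b))"
      using step.hyps(1) g(1) by (intro hull.step) simp_all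
    moreover have "c * s + f - (c * u4 ^ b + g) * ffact4 r = f - g * ffact4 r"
      by (simp add: s True algebra_simps)
    then have "c * s + f - (c * u4 ^ b + g) * ffact4 r \<in> u_ffacts p d r" using g(2) by (simp only:)
    ultimately show ?thesis by (rule bexI[rotated])
  next
    case False
    then have "a < r" using s(3) by simp
    with s(1,2) have "s \<in> {u4 ^ b * ffact4 a | a b. a + b < d \<and> a < r}" by blast
    from hull.step[OF step.hyps(1) this g(2)]
    have "c * s + (f - g * ffact4 r) \<in> u_ffacts p d r" .
    then have "c * s + f - g * ffact4 r \<in> u_ffacts p d r" by (simp only: add_diff_eq)
    then show ?thesis using g(1) by (rule bexI)
  qed
qed

lemma Delta4_pow_u_ffacts_eq_0:
  assumes "prime p" and "CHAR('k::comm_ring_1) = p" and "f \<in> u_ffacts p d n"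
  shows "(Delta4 ^^ n) f = (0 :: 'k poly4)"
proof -
  have "(Delta4 ^^ n) f \<in> hull (algA p) {}"
    by (rule hull_Delta4_pow[OF assms])
      (auto simp: Delta4_pow_times Delta4_pow_ffact4_eq_0 hull.zero)
  then show ?thesis by (simp add: hull_empty)
qed

text \<open>The falling factorials are independent over the invariants, since \<open>\<Delta>\<^sup>r\<close> isolates the
  coefficient of the longest one.\<close>

lemma kernel_Delta4_pow_u_ffacts:
  assumes "prime p" and "CHAR('k::field) = p" and "f \<in> u_ffacts p d m" and "m \<le> p"
    and "(Delta4 ^^ n) f = (0 :: 'k poly4)" and "n \<le> m"
  shows "f \<in> u_ffacts p d n"
  using assms(6,3,4)
proof (induction m rule: dec_induct)
  case (step r)
  obtain g where g: "g \<in> hull (algA p) (range (\<lambda>b. u4 ^ b))" "f - g * ffact4 r \<in> u_ffacts p d r"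
    using u_ffacts_Suc_split step.prems(1) by blast
  have "sigma4 g = g"
    using g(1) by (induction g rule: hull.induct) (auto simp: sigma4_algA[OF assms(1,2)])
  then have "(Delta4 ^^ r) (f - g * ffact4 r) = (Delta4 ^^ r) f - of_nat (fact r) * (X3 ^ r * g)"
    by (simp add: Delta4_pow_diff Delta4_pow_times Delta4_pow_ffact4_self mult_ac)
  \<comment> \<open>Since \<open>n \<le> r\<close>, the power \<open>Delta4 ^^ r\<close> kills
    \<open>f\<close>, and it kills the shorter terms as well. Only
    \<open>fact r * X3 ^ r * g\<close> remains, with \<open>fact r\<close> invertible because
    \<open>r < p\<close>.\<close>
  moreover have "(Delta4 ^^ r) f = (Delta4 ^^ ((r - n) + n)) f" using step.hyps(1) by simp
  then have "(Delta4 ^^ r) f = 0" unfolding Delta4_pow_pow[symmetric] assms(5) by simp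
  ultimately have "of_nat (fact r) * (X3 ^ r * g) = 0"
    using Delta4_pow_u_ffacts_eq_0[OF assms(1,2) g(2)] by simp
  then have "X3 ^ r * g = 0"
    by (rule of_nat_fact_times_eq_0D[OF assms(1,2), rotated]) (use step.prems(2) in simp)
  then have "g = 0" by (rule X3_power_times_eq_0D)
  with g(2) step show ?case by simp
qed simp

section \<open>Localized spanning\<close>

lemma homogeneous_base:
  "i + j = d \<Longrightarrow> X1 ^ i * X2 ^ j \<in> hull (algA p) {X1 ^ i * X2 ^ j | i j. i + j = d}"
  by (intro algA.hull_base) blast

text \<open>\<open>u4\<close> is a linear form in \<open>X1\<close> and \<open>X2\<close> with
  coefficients in \<open>algA p\<close>.\<close>

lemma u4_power_X1_power:
  "u4 ^ b * X1 ^ c \<in> hull (algA p) {X1 ^ i * X2 ^ j :: 'k::comm_ring_1 poly4 | i j. i + j = b + c}"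
proof (induction b)
  case 0
  have "X1 ^ c * X2 ^ 0 \<in> hull (algA p) {X1 ^ i * X2 ^ j :: 'k poly4 | i j. i + j = 0 + c}"
    by (rule homogeneous_base) simp
  then show ?case by simp
next
  case (Suc b)
  let ?H = "hull (algA p) {X1 ^ i * X2 ^ j :: 'k poly4 | i j. i + j = Suc b + c}"
  have "u4 * (X1 ^ i * X2 ^ j) \<in> ?H" if "i + j = b + c" for i j
  proof -
    have "X1 ^ Suc i * X2 ^ j \<in> ?H" "X1 ^ i * X2 ^ Suc j \<in> ?H"
      using that by (simp_all only: homogeneous_base add_Suc add_Suc_right)
    then have "X4 * (X1 ^ Suc i * X2 ^ j) - X3 * (X1 ^ i * X2 ^ Suc j) \<in> ?H"
      by (intro algA.hull_diff) (erule algA.hull_scale, rule algA_generators)+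
    then show ?thesis by (simp add: u4_def algebra_simps)
  qed
  then have "u4 * (u4 ^ b * X1 ^ c) \<in> ?H"
    by (auto intro!: algA.hull_times[OF Suc])
  then show ?case by (simp add: mult.assoc)
qed

lemma ffact4_in_hull: "ffact4 a \<in> hull (algA p) {X1 ^ c :: 'k::comm_ring_1 poly4 | c. c \<le> a}"
proof (induction a)
  case 0
  show ?case by (intro algA.hull_base) simp
next
  case (Suc a)
  let ?H = "hull (algA p) {X1 ^ c :: 'k poly4 | c. c \<le> Suc a}"
  have "X1 * X1 ^ c \<in> ?H" if "c \<le> a" for c
    using that by (intro algA.hull_base CollectI exI[of _ "Suc c"]) simp
  then have *: "X1 * ffact4 a \<in> ?H"
    by (auto intro!: algA.hull_times[OF Suc])
  have "ffact4 a \<in> ?H"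
    using Suc by (rule subsetD[OF hull_mono, rotated]) (blast intro: le_SucI)
  then have "(of_nat a * X3) * ffact4 a \<in> ?H"
    by (rule algA.hull_scale) (intro algA_intros)
  from algA.hull_diff[OF * this] show ?case by (simp add: ffact4_Suc algebra_simps)
qed

text \<open>Expand \<open>ffact4 a\<close> into powers \<open>X1 ^ c\<close>. If
  \<open>b + c < n\<close>, expanding \<open>u4\<close> too gives elements of \<open>M\<close>;
  otherwise only part of the power of \<open>u4\<close> is expanded, giving elements of
  \<open>U\<close>.\<close>

lemma u_ffacts_in_hull_basisS:
  assumes "1 \<le> n" and "n \<le> p" and "f \<in> u_ffacts p p n"
  shows "f \<in> hull (algA p) (basisS p n :: 'k::comm_ring_1 poly4 set)"
proof (rule algA.hull_subset[OF assms(3)], safe)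
  fix a b assume ab: "a + b < p" "a < n"
  have "u4 ^ b * X1 ^ c \<in> hull (algA p) (basisS p n :: 'k poly4 set)" if "c \<le> a" for c
  proof (cases "b + c < n")
    case True
    have "{X1 ^ i * X2 ^ j | i j. i + j = b + c} \<subseteq> (basisS p n :: 'k poly4 set)"
    proof
      fix f :: "'k poly4" assume "f \<in> {X1 ^ i * X2 ^ j | i j. i + j = b + c}"
      then obtain i j where f: "f = X1 ^ i * X2 ^ j" "i + j = b + c" by blast
      with True assms(2) have "i < p" "j < p" by linarith+
      with f have "f \<in> Mk p (b + c)" unfolding Mk_def by blast
      then show "f \<in> basisS p n" using True unfolding basisS_def by auto
    qed
    then show ?thesis using u4_power_X1_power[of b c p] hull_mono by blast
  next
    case False
    \<comment> \<open>Keeping \<open>u4 ^ k\<close> leaves a factor of degree exactly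
      \<open>n - 1\<close>. The bound \<open>k \<le> p - n\<close> comes from
      \<open>c \<le> a\<close> and \<open>a + b < p\<close>.\<close>
    define k where "k = b + c - (n - 1)"
    have k: "k \<in> {1..p-n}" "b = k + (n - 1 - c)" "n - 1 - c + c = n - 1"
      using False ab that assms(1) by (auto simp: k_def)
    have "u4 ^ k * (X1 ^ i * X2 ^ j) \<in> (basisS p n :: 'k poly4 set)" if "i + j = n - 1" for i j
    proof -
      have "i < p" "j < p" using that assms(1,2) by linarith+
      with that have "X1 ^ i * X2 ^ j \<in> (Mk p (n - 1) :: 'k poly4 set)" unfolding Mk_def by blast
      then show ?thesis using k(1) unfolding basisS_def by blast
    qed
    then have "u4 ^ k * (u4 ^ (n - 1 - c) * X1 ^ c) \<in> hull (algA p) (basisS p n :: 'k poly4 set)"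
      using k(3) by (intro algA.hull_times[OF u4_power_X1_power]) (auto intro: algA.hull_base)
    then show ?thesis by (simp add: k(2) power_add mult.assoc)
  qed
  then show "u4 ^ b * ffact4 a \<in> hull (algA p) (basisS p n :: 'k poly4 set)"
    by (auto intro!: algA.hull_times[OF ffact4_in_hull])
qed

lemma Kn_localized_span:
  assumes "prime p" and "CHAR('k::field) = p" and "1 \<le> n" and "n \<le> p" and "f \<in> Kn n"
  shows "\<exists>m. X3 ^ m * f \<in> hull (algA p) (basisS p n :: 'k poly4 set)"
proof -
  have p: "1 < p" using assms(1) by (rule prime_gt_1_nat)
  obtain m g where g: "X3 ^ m * f = (Delta4 ^^ (p - n)) g"
    using kernel_Delta4_pow_in_image[OF assms(1,2,4)] assms(5) unfolding Kn_def by blast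
  have "X3 ^ p * (Delta4 ^^ (p - n)) g \<in> hull (algA p) (basisS p n)"
  proof (rule algA.hull_linear[OF hull_monomials_UNIV[OF p],
        where L = "\<lambda>g. X3 ^ p * (Delta4 ^^ (p - n)) g"])
    fix s :: "'k poly4" assume "s \<in> (\<lambda>(i,j). X1 ^ i * X2 ^ j) ` ({..<p} \<times> {..<p})"
    then obtain i j where s: "s = X1 ^ i * X2 ^ j" "i < p" "j < p" by auto
    show "X3 ^ p * (Delta4 ^^ (p - n)) s \<in> hull (algA p) (basisS p n)"
    \<comment> \<open>Below this degree the image has degree less than \<open>p\<close>, so
      \<open>X3 ^ p\<close> moves it into the span of the \<open>u4 ^ b * ffact4 a\<close>, and
      being killed by \<open>Delta4 ^^ n\<close> forces \<open>a < n\<close>. From this degree on,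
      the image itself belongs to \<open>D\<close>.\<close>
    proof (cases "i + j < p - n + p")
      case True
      then have "s \<in> polys_less p (p - n + p)" unfolding s(1) by (rule polys_less_base)
      then have "X3 ^ p * (Delta4 ^^ (p - n)) s \<in> u_ffacts p p p"
        by (rule X3_power_polys_less_in_u_ffacts[OF Delta4_pow_polys_less[OF assms(1,2)]])
      moreover have "(Delta4 ^^ n) (X3 ^ p * (Delta4 ^^ (p - n)) s) = 0"
        using assms(4) by (simp add: s(1) Delta4_pow_times Delta4_pow_pow Delta4_pow_p_monomial[OF assms(1,2)])
      ultimately have "X3 ^ p * (Delta4 ^^ (p - n)) s \<in> u_ffacts p p n"
        using kernel_Delta4_pow_u_ffacts[OF assms(1,2) _ order_refl] assms(4) by blast
      then show ?thesis by (rule u_ffacts_in_hull_basisS[OF assms(3,4)])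
    next
      case False
      then have "i + j \<in> {2*p-n..2*p-2}" using s(2,3) assms(4) unfolding atLeastAtMost_iff by linarith
      moreover have "s \<in> Mk p (i + j)" unfolding Mk_def using s by blast
      ultimately have "(Delta4 ^^ (p - n)) s \<in> basisS p n" unfolding basisS_def by blast
      then have "(Delta4 ^^ (p - n)) s \<in> hull (algA p) (basisS p n)" by (rule algA.hull_base)
      then show ?thesis by (rule algA.hull_scale) (intro algA_intros)
    qed
  next
    fix a s h :: "'k poly4" assume "a \<in> algA p"
    then have "(Delta4 ^^ (p - n)) (a * s + h) = a * (Delta4 ^^ (p - n)) s + (Delta4 ^^ (p - n)) h"
      by (simp add: Delta4_pow_add Delta4_pow_times sigma4_algA[OF assms(1,2)])
    then show "X3 ^ p * (Delta4 ^^ (p - n)) (a * s + h)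
        = a * (X3 ^ p * (Delta4 ^^ (p - n)) s) + X3 ^ p * (Delta4 ^^ (p - n)) h"
      by (simp add: algebra_simps)
  qed simp
  then have "X3 ^ (p + m) * f \<in> hull (algA p) (basisS p n)"
    by (simp add: power_add mult.assoc g)
  then show ?thesis ..
qed

section \<open>Independence modulo the third variable\<close>

lemma X3_dvd_diff_power:
  assumes "X3 dvd f - (g :: 'k::comm_ring_1 poly4)"
  shows "X3 dvd f ^ n - g ^ n"
proof (induction n)
  case (Suc n)
  have "f ^ Suc n - g ^ Suc n = f * (f ^ n - g ^ n) + (f - g) * g ^ n" by (simp add: algebra_simps)
  then show ?case using Suc assms by (metis dvd_add dvd_mult dvd_mult2)
qed simp

lemma X3_dvd_Delta4:
  assumes "X3 dvd f"
  shows "X3 dvd Delta4 f"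
proof -
  obtain g where "f = X3 * g" using assms by (auto simp: dvd_def)
  then have "Delta4 f = X3 * Delta4 g" by (simp add: Delta4_def algebra_simps)
  then show ?thesis by simp
qed

text \<open>Modulo \<open>X3\<close> the action fixes \<open>X1\<close>, so \<open>Delta4\<close>
  treats it as a scalar.\<close>

lemma Delta4_pow_X1_times_cong:
  "X3 dvd (Delta4 ^^ r) (X1 ^ i * h) - X1 ^ i * (Delta4 ^^ r) (h :: 'k::comm_ring_1 poly4)"
proof (induction r)
  case (Suc r)
  define f g where "f = (Delta4 ^^ r) (X1 ^ i * h)" and "g = (Delta4 ^^ r) h"
  have "X3 dvd Delta4 (f - X1 ^ i * g)" using Suc unfolding f_def g_def by (rule X3_dvd_Delta4)
  moreover have "X3 dvd ((X1 + X3) ^ i - X1 ^ i :: 'k poly4)" by (rule X3_dvd_diff_power) simp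
  then have "X3 dvd ((X1 + X3) ^ i - X1 ^ i) * sigma4 g" by (rule dvd_mult2)
  ultimately have "X3 dvd Delta4 (f - X1 ^ i * g) + ((X1 + X3) ^ i - X1 ^ i) * sigma4 g"
    by (rule dvd_add)
  also have "Delta4 (f - X1 ^ i * g) + ((X1 + X3) ^ i - X1 ^ i) * sigma4 g
      = Delta4 f - X1 ^ i * Delta4 g"
    by (simp only: Delta4_def sigma4_hom) (simp add: algebra_simps)
  finally show ?case by (simp add: f_def g_def)
qed simp

section \<open>Leading terms with respect to the degree in \<open>X2\<close>\<close>

abbreviation X2_polys :: "nat \<Rightarrow> nat \<Rightarrow> 'k::comm_ring_1 poly4 set" where
  "X2_polys p l \<equiv> hull (algA p) {X2 ^ m | m. m < l}"

lemma X2_polys_mono: "f \<in> X2_polys p l \<Longrightarrow> l \<le> l' \<Longrightarrow> f \<in> X2_polys p l'"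
  by (erule subsetD[OF hull_mono, rotated]) (blast intro: less_le_trans)

lemma X2_polys_base: "m < l \<Longrightarrow> X2 ^ m \<in> X2_polys p l"
  by (intro algA.hull_base) blast

lemma X2_times_X2_polys:
  assumes "f \<in> X2_polys p l"
  shows "X2 * f \<in> (X2_polys p (Suc l) :: 'k::comm_ring_1 poly4 set)"
proof -
  have "X2 * X2 ^ m \<in> (X2_polys p (Suc l) :: 'k poly4 set)" if "m < l" for m
    using X2_polys_base[of "Suc m" "Suc l" p] that by simp
  then show ?thesis by (auto intro!: algA.hull_times[OF assms])
qed

lemma Delta4_X2_power:
  "Delta4 (X2 ^ Suc l) - of_nat (Suc l) * X4 * X2 ^ l \<in> (X2_polys p l :: 'k::comm_ring_1 poly4 set)"
proof (induction l)
  case 0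
  show ?case by (simp add: Delta4_def hull.zero)
next
  case (Suc l)
  let ?D = "Delta4 (X2 ^ Suc l) :: 'k poly4" and ?t = "of_nat (Suc l) * X4 * X2 ^ l :: 'k poly4"
  have "?t \<in> X2_polys p (Suc l)"
    by (rule algA.hull_scale[OF X2_polys_base]) (simp, intro algA_intros)
  then have "(?D - ?t) + ?t \<in> X2_polys p (Suc l)"
    by (rule hull_add[OF X2_polys_mono[OF Suc le_SucI[OF order_refl]]])
  then have "X4 * ?D \<in> X2_polys p (Suc l)"
    unfolding diff_add_cancel by (rule algA.hull_scale) (rule algA_generators)
  then have "X2 * (?D - ?t) + X4 * ?D \<in> X2_polys p (Suc l)"
    by (rule hull_add[OF X2_times_X2_polys[OF Suc]])
  also have "X2 * (?D - ?t) + X4 * ?D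
      = (X4 * X2 ^ Suc l + (X2 + X4) * ?D) - of_nat (Suc (Suc l)) * X4 * X2 ^ Suc l"
    by (simp add: algebra_simps)
  also have "X4 * X2 ^ Suc l + (X2 + X4) * ?D = Delta4 (X2 ^ Suc (Suc l))"
    by (simp only: Delta4_X2_times power_Suc)
  finally show ?case .
qed

lemma Delta4_X2_polys:
  assumes "prime p" and "CHAR('k::comm_ring_1) = p" and "f \<in> X2_polys p (Suc l)"
  shows "Delta4 f \<in> (X2_polys p l :: 'k poly4 set)"
proof -
  have "Delta4 (X2 ^ m) \<in> (X2_polys p l :: 'k poly4 set)" if "m < Suc l" for m
  proof (cases m)
    case 0
    then show ?thesis by (simp add: Delta4_def hull.zero)
  next
    case (Suc k)
    have t: "of_nat (Suc k) * X4 * X2 ^ k \<in> (X2_polys p l :: 'k poly4 set)"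
      using that Suc by (intro algA.hull_scale[OF X2_polys_base] algA_intros) simp
    have "Delta4 (X2 ^ Suc k) - of_nat (Suc k) * X4 * X2 ^ k \<in> (X2_polys p l :: 'k poly4 set)"
      using that Suc by (intro X2_polys_mono[OF Delta4_X2_power]) simp
    from hull_add[OF this t] show ?thesis by (simp only: Suc diff_add_cancel)
  qed
  then have "(Delta4 ^^ 1) f \<in> X2_polys p l"
    by (intro hull_Delta4_pow[OF assms]) auto
  then show ?thesis by simp
qed

text \<open>The constant is the product of \<open>l + 1\<close> up to \<open>l + r\<close>; no
  factor is divisible by \<open>p\<close> because \<open>r + l < p\<close>.\<close>

lemma Delta4_pow_X2_power:
  assumes "prime p" and "CHAR('k::field) = p" and "r + l < p"
  shows "\<exists>c. c \<noteq> 0 \<and> (Delta4 ^^ r) (X2 ^ (r + l)) - const4 c * X4 ^ r * X2 ^ l \<in> (X2_polys p l :: 'k poly4 set)"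
  using assms(3)
proof (induction r arbitrary: l)
  case 0
  show ?case by (intro exI[of _ 1]) (simp add: const4_hom hull.zero)
next
  case (Suc r)
  obtain c where c: "c \<noteq> 0"
    "(Delta4 ^^ r) (X2 ^ (r + Suc l)) - const4 c * X4 ^ r * X2 ^ Suc l \<in> (X2_polys p (Suc l) :: 'k poly4 set)"
    using Suc.IH[of "Suc l"] Suc.prems by auto
  define b :: "'k poly4" where "b = const4 c * X4 ^ r"
  have b: "sigma4 b = b" "b \<in> algA p" unfolding b_def by (simp, intro algA_intros)
  have "\<not> p dvd Suc l" using Suc.prems by (auto dest: dvd_imp_le)
  then have "of_nat (Suc l) \<noteq> (0 :: 'k)"
    using of_nat_eq_0_iff_char_dvd[of "Suc l", where 'a = 'k] assms(2) by blast
  then have c': "c * of_nat (Suc l) \<noteq> 0" using c(1) by simp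
  have "Delta4 ((Delta4 ^^ r) (X2 ^ (r + Suc l)) - b * X2 ^ Suc l) \<in> X2_polys p l"
    using c(2) unfolding b_def by (rule Delta4_X2_polys[OF assms(1,2)])
  moreover have "b * (Delta4 (X2 ^ Suc l) - of_nat (Suc l) * X4 * X2 ^ l) \<in> X2_polys p l"
    using Delta4_X2_power b(2) by (rule algA.hull_scale)
  ultimately have "Delta4 ((Delta4 ^^ r) (X2 ^ (r + Suc l)) - b * X2 ^ Suc l)
     + b * (Delta4 (X2 ^ Suc l) - of_nat (Suc l) * X4 * X2 ^ l) \<in> X2_polys p l"
    by (rule hull_add)
  also have "Delta4 ((Delta4 ^^ r) (X2 ^ (r + Suc l)) - b * X2 ^ Suc l)
      = Delta4 ((Delta4 ^^ r) (X2 ^ (r + Suc l))) - b * Delta4 (X2 ^ Suc l)"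
    by (simp only: Delta4_diff Delta4_times[OF b(1)])
  also have "Delta4 ((Delta4 ^^ r) (X2 ^ (r + Suc l))) - b * Delta4 (X2 ^ Suc l)
     + b * (Delta4 (X2 ^ Suc l) - of_nat (Suc l) * X4 * X2 ^ l)
     = Delta4 ((Delta4 ^^ r) (X2 ^ (r + Suc l))) - of_nat (Suc l) * (b * X4 * X2 ^ l)"
    by (simp add: algebra_simps)
  also have "of_nat (Suc l) * (b * X4 * X2 ^ l) = const4 (c * of_nat (Suc l)) * X4 ^ Suc r * X2 ^ l"
    by (simp only: b_def const4_hom power_Suc mult_ac)
  finally show ?case using c' by (intro exI[of _ "c * of_nat (Suc l)"]) simp
qed

text \<open>The leading coefficient is a unit times a power of \<open>X4\<close>, which can be
  cancelled modulo \<open>X3\<close> though not inverted. The remainder keeps the factor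
  \<open>X1 ^ i\<close> and drops only in the degree in \<open>X2\<close>.\<close>

definition leads_mod_X3 :: "nat \<Rightarrow> nat \<Rightarrow> nat \<Rightarrow> 'k::field poly4 \<Rightarrow> bool" where
  "leads_mod_X3 p i j s \<longleftrightarrow> (\<exists>c e r. c \<noteq> 0 \<and> r \<in> X2_polys p j \<and>
     X3 dvd s - (const4 c * X4 ^ e * (X1 ^ i * X2 ^ j) + X1 ^ i * r))"

lemma leads_mod_X3I:
  assumes "c \<noteq> 0" and "r \<in> X2_polys p j"
    and "X3 dvd s - (const4 c * X4 ^ e * (X1 ^ i * X2 ^ j) + X1 ^ i * r)"
  shows "leads_mod_X3 p i j s"
  unfolding leads_mod_X3_def using assms by (intro exI conjI)

lemma algA_X3_dvdD:
  assumes "1 < p" and "a \<in> algA p" and "X3 dvd (a :: 'k::comm_ring_1 poly4)"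
  shows "\<exists>b\<in>algA p. a = X3 * b"
proof -
  \<comment> \<open>\<open>a\<close> is viewed as the coefficient of the monomial 1; this gives a
    quotient that is again in \<open>algA p\<close>.\<close>
  let ?a = "\<lambda>i j. if i = 0 \<and> j = 0 then a else 0"
  have "(\<Sum>i<p. \<Sum>j<p. ?a i j * (X1 ^ i * X2 ^ j)) = (\<Sum>i<p. \<Sum>j<p. if j = 0 then (if i = 0 then a else 0) else 0)"
    by (intro sum.cong refl) auto
  also have "\<dots> = a" using assms(1) by simp
  finally have "X3 dvd (\<Sum>i<p. \<Sum>j<p. ?a i j * (X1 ^ i * X2 ^ j))" using assms(3) by simp
  from X3_dvd_monomial_sumD[OF assms(1) _ this, of 0 0] show ?thesis
    using assms(1,2) by (auto simp: algA.zero_mem)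
qed

abbreviation monomials :: "nat \<Rightarrow> nat \<Rightarrow> 'k::comm_ring_1 poly4 set" where
  "monomials p k \<equiv> (\<lambda>(i,j). X1 ^ i * X2 ^ j) ` ({..<p} \<times> {..<k})"

lemma X3_dvd_top_coeffD:
  assumes "k < p" and "1 < p" and "\<And>i. i < p \<Longrightarrow> d i \<in> algA p" and "h \<in> hull (algA p) (monomials p k)"
    and "X3 dvd (\<Sum>i<p. d i * (X1 ^ i * X2 ^ k)) + h" and "i < p"
  shows "X3 dvd (d i :: 'k::comm_ring_1 poly4)"
proof -
  obtain b where b: "\<And>x. b x \<in> algA p" "h = (\<Sum>x\<in>{..<p} \<times> {..<k}. b x * (case x of (i,j) \<Rightarrow> X1 ^ i * X2 ^ j))"
    using algA.hull_family[OF assms(4)] by blast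
  \<comment> \<open>One full table of coefficients: the lower rows from \<open>h\<close>, the row
    \<open>k\<close> from \<open>d\<close>, and zeros above it.\<close>
  define D where "D = (\<lambda>i j. if j < k then b (i,j) else if j = k then d i else 0)"
  have "(\<Sum>j<p. D i j * (X1 ^ i * X2 ^ j)) = (\<Sum>j<k. b (i,j) * (X1 ^ i * X2 ^ j)) + d i * (X1 ^ i * X2 ^ k)" for i
  proof -
    have "(\<Sum>j<p. D i j * (X1 ^ i * X2 ^ j)) = (\<Sum>j<Suc k. D i j * (X1 ^ i * X2 ^ j))"
      using assms(1) by (intro sum.mono_neutral_right) (auto simp: D_def)
    then show ?thesis by (simp add: D_def)
  qed
  then have "(\<Sum>i<p. \<Sum>j<p. D i j * (X1 ^ i * X2 ^ j)) = (\<Sum>i<p. d i * (X1 ^ i * X2 ^ k)) + h"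
    by (simp add: sum.distrib b(2) sum.cartesian_product split_def add.commute)
  with assms(5) have *: "X3 dvd (\<Sum>i<p. \<Sum>j<p. D i j * (X1 ^ i * X2 ^ j))" by simp
  have "D i j \<in> algA p" if "i < p" for i j
    using b(1) assms(3) that by (simp add: D_def algA.zero_mem)
  from X3_dvd_monomial_sumD[OF assms(2) this * assms(6,1)] show ?thesis by (auto simp: D_def)
qed

text \<open>Triangularity: modulo \<open>X3\<close> the monomials with \<open>X2\<close>-degree
  \<open>k\<close> arise only from the leading terms of the top row. Freeness makes
  \<open>X3\<close> divide those coefficients, after cancelling the power of \<open>X4\<close> and
  the constant; the row is then discarded.\<close>

lemma leads_mod_X3_independent:
  assumes "1 < p" and "k \<le> p" and "\<And>i j. i < p \<Longrightarrow> j < k \<Longrightarrow> a i j \<in> algA p"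
    and "\<And>i j. i < p \<Longrightarrow> j < k \<Longrightarrow> leads_mod_X3 p i j (s i j)"
    and "X3 dvd (\<Sum>j<k. \<Sum>i<p. a i j * s i j)" and "i < p" and "j < k"
  shows "X3 dvd (a i j :: 'k::field poly4)"
  using assms(2-7)
proof (induction k arbitrary: j)
  case (Suc k)
  \<comment> \<open>Bundling the three witnesses in one predicate lets them be chosen together as
    functions of \<open>i\<close> and \<open>j\<close>.\<close>
  define P where "P i j c e r \<longleftrightarrow> c \<noteq> 0 \<and> r \<in> X2_polys p j \<and>
      X3 dvd s i j - (const4 c * X4 ^ e * (X1 ^ i * X2 ^ j) + X1 ^ i * r)" for i j c e r
  have "leads_mod_X3 p i j (s i j) \<longleftrightarrow> (\<exists>c e r. P i j c e r)" for i j
    unfolding leads_mod_X3_def P_def ..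
  with Suc.prems(3) have "\<forall>i j. \<exists>c e r. i < p \<longrightarrow> j < Suc k \<longrightarrow> P i j c e r" by blast
  then obtain c e r where "\<And>i j. i < p \<Longrightarrow> j < Suc k \<Longrightarrow> P i j (c i j) (e i j) (r i j)" by metis
  then have lead: "c i j \<noteq> 0 \<and> r i j \<in> X2_polys p j \<and>
      X3 dvd s i j - (const4 (c i j) * X4 ^ e i j * (X1 ^ i * X2 ^ j) + X1 ^ i * r i j)"
    if "i < p" "j < Suc k" for i j
    using that unfolding P_def by blast
  define t where "t = (\<lambda>i j. const4 (c i j) * X4 ^ e i j * (X1 ^ i * X2 ^ j) + X1 ^ i * r i j)"
  have dvd: "X3 dvd a i j * s i j - a i j * t i j" if "i < p" "j < Suc k" for i j
    using lead[OF that] unfolding t_def right_diff_distrib[symmetric] by (intro dvd_mult) blast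
  let ?H = "hull (algA p) (monomials p k) :: 'k poly4 set"
  have base: "X1 ^ i * X2 ^ j \<in> ?H" if "i < p" "j < k" for i j
    using that by (intro algA.hull_base image_eqI[of _ _ "(i,j)"]) auto
  have low: "X1 ^ i * r i j \<in> ?H" if "i < p" "j < Suc k" for i j
  proof (rule algA.hull_times)
    show "r i j \<in> X2_polys p j" using lead that by blast
    show "X1 ^ i * x \<in> ?H" if x: "x \<in> {X2 ^ m | m. m < j}" for x
    proof -
      obtain m where "x = X2 ^ m" "m < j" using x by blast
      then show ?thesis using base[OF \<open>i < p\<close>, of m] \<open>j < Suc k\<close> by simp
    qed
  qed
  have A: "a i j \<in> algA p" if "i < p" "j < Suc k" for i j using Suc.prems(2) that by blast
  have t: "a i j * t i j \<in> ?H" if "i < p" "j < k" for i j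
  proof -
    have "const4 (c i j) * X4 ^ e i j * (X1 ^ i * X2 ^ j) \<in> ?H"
      by (rule algA.hull_scale[OF base[OF that]]) (intro algA_intros)
    then have "t i j \<in> ?H" unfolding t_def by (rule hull_add) (use low that in simp)
    then show ?thesis using A that by (intro algA.hull_scale) auto
  qed
  \<comment> \<open>Everything of \<open>X2\<close>-degree below \<open>k\<close>: the lower rows in
    full and the remainders of row \<open>k\<close>.\<close>
  define h where "h = (\<Sum>j<k. \<Sum>i<p. a i j * t i j) + (\<Sum>i<p. a i k * (X1 ^ i * r i k))"
  have h: "h \<in> ?H"
    unfolding h_def
  proof (rule hull_add)
    show "(\<Sum>j<k. \<Sum>i<p. a i j * t i j) \<in> ?H" by (intro hull_sum t) simp_all
    show "(\<Sum>i<p. a i k * (X1 ^ i * r i k)) \<in> ?H" by (intro hull_sum algA.hull_scale[OF low A]) simp_all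
  qed
  have "X3 dvd (\<Sum>j<Suc k. \<Sum>i<p. a i j * s i j - a i j * t i j)"
    by (intro dvd_sum dvd) auto
  then have "X3 dvd (\<Sum>j<Suc k. \<Sum>i<p. a i j * s i j) - (\<Sum>j<Suc k. \<Sum>i<p. a i j * t i j)"
    by (simp only: sum_subtractf)
  from dvd_diff[OF Suc.prems(4) this] have "X3 dvd (\<Sum>j<Suc k. \<Sum>i<p. a i j * t i j)"
    by (simp only: diff_diff_eq2 add_diff_cancel_left')
  also have "(\<Sum>j<Suc k. \<Sum>i<p. a i j * t i j)
      = (\<Sum>i<p. (a i k * const4 (c i k) * X4 ^ e i k) * (X1 ^ i * X2 ^ k)) + h"
  proof -
    have "(\<Sum>i<p. a i k * t i k) = (\<Sum>i<p. (a i k * const4 (c i k) * X4 ^ e i k) * (X1 ^ i * X2 ^ k))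
        + (\<Sum>i<p. a i k * (X1 ^ i * r i k))"
      unfolding sum.distrib[symmetric] t_def
      by (intro sum.cong refl) (simp only: distrib_left mult.assoc)
    then show ?thesis unfolding h_def sum.lessThan_Suc by (simp only: add_ac)
  qed
  finally have top: "X3 dvd (\<Sum>i<p. (a i k * const4 (c i k) * X4 ^ e i k) * (X1 ^ i * X2 ^ k)) + h" .
  have top_dvd: "X3 dvd a i k" if "i < p" for i
  proof -
    have "X3 dvd a i k * const4 (c i k) * X4 ^ e i k"
    proof (rule X3_dvd_top_coeffD[OF _ assms(1) _ h top that])
      show "k < p" using Suc.prems(1) by simp
      show "a i k * const4 (c i k) * X4 ^ e i k \<in> algA p" if "i < p" for i
        using A[OF that, of k] by (intro algA.mult_mem algA.power_mem algA_generators) simp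
    qed
    then have "X3 dvd X4 ^ e i k * (const4 (c i k) * a i k)" by (simp only: mult_ac)
    then have "X3 dvd const4 (c i k) * a i k" by (rule X3_dvd_X4_power_timesD)
    then have "X3 dvd const4 (inverse (c i k)) * (const4 (c i k) * a i k)" by (rule dvd_mult)
    moreover have "c i k \<noteq> 0" using lead[OF that, of k] by blast
    ultimately show ?thesis using const4_times_cancel[of "c i k" "a i k"] by simp
  qed
  have "X3 dvd (\<Sum>i<p. a i k * s i k)" by (intro dvd_sum dvd_mult2 top_dvd) simp
  from dvd_diff[OF Suc.prems(4) this] have "X3 dvd (\<Sum>j<k. \<Sum>i<p. a i j * s i j)"
    by (simp only: sum.lessThan_Suc add_diff_cancel_right')
  then have "X3 dvd a i j" if "j < k"
    using Suc.IH[OF _ _ _ _ _ that] Suc.prems(1,2,3,5) by simp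
  then show ?case using top_dvd Suc.prems(5,6) less_Suc_eq by blast
qed simp

section \<open>The basis\<close>

text \<open>Modulo \<open>x\<^sub>3\<close>, the element with index \<open>(i,j)\<close> has leading monomial \<open>x\<^sub>1\<^sup>i x\<^sub>2\<^sup>j\<close> with respect to
  the degree in \<open>x\<^sub>2\<close>.\<close>

definition basis_elem :: "nat \<Rightarrow> nat \<Rightarrow> nat \<Rightarrow> nat \<Rightarrow> 'k::comm_ring_1 poly4" where
  "basis_elem p n i j =
     (if i + j < n then X1 ^ i * X2 ^ j
      else if i + j < p then u4 ^ (i + j - (n - 1)) * (X1 ^ (n - 1 - j) * X2 ^ j)
      else (Delta4 ^^ (p - n)) (X1 ^ i * X2 ^ (p - n + j)))"

text \<open>An element of \<open>M\<close> is indexed by its exponents,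
  \<open>u4 ^ k * (X1 ^ i * X2 ^ j)\<close> by \<open>(k + i, j)\<close>, and the image of
  \<open>X1 ^ i * X2 ^ j\<close> in \<open>D\<close> by \<open>(i, j - (p - n))\<close>. The sum of
  the two indices tells the three kinds apart.\<close>

lemma basisS_eq_image:
  assumes "1 \<le> n" and "n \<le> p"
  shows "basisS p n = (\<lambda>(i,j). basis_elem p n i j :: 'k::comm_ring_1 poly4) ` ({..<p} \<times> {..<n})"
    (is "_ = ?R")
proof
  have R: "f \<in> ?R" if "f = basis_elem p n i j" "i < p" "j < n" for f i j
    using that by (auto intro!: image_eqI[of _ _ "(i,j)"])
  show "basisS p n \<subseteq> ?R"
  proof
    fix f :: "'k poly4" assume "f \<in> basisS p n"
    then consider k where "k < n" "f \<in> Mk p k"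
      | k m where "1 \<le> k" "k \<le> p - n" "m \<in> Mk p (n - 1)" "f = u4 ^ k * m"
      | k m where "2 * p - n \<le> k" "m \<in> Mk p k" "f = (Delta4 ^^ (p - n)) m"
      unfolding basisS_def by auto
    then show "f \<in> ?R"
    proof cases
      case 1
      then obtain i j where "f = X1 ^ i * X2 ^ j" "i + j = k" "i < p" unfolding Mk_def by blast
      with 1 assms show ?thesis by (intro R[of _ i j]) (auto simp: basis_elem_def)
    next
      case 2
      then obtain i j where m: "m = X1 ^ i * X2 ^ j" "i + j = n - 1" unfolding Mk_def by blast
      then have i: "\<not> k + i + j < n" "k + i + j < p" "k + i + j - (n - 1) = k" "n - 1 - j = i"
        using 2 assms by linarith+
      have "f = basis_elem p n (k + i) j" using i 2(4) m(1) by (simp add: basis_elem_def)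
      moreover have "k + i < p" "j < n" using i m(2) assms by linarith+
      ultimately show ?thesis by (rule R)
    next
      case 3
      then obtain i j where m: "m = X1 ^ i * X2 ^ j" "i + j = k" "i < p" "j < p" unfolding Mk_def by blast
      \<comment> \<open>The subtraction is not truncated: \<open>i < p\<close> and
        \<open>i + j \<ge> 2 * p - n\<close> force \<open>j > p - n\<close>.\<close>
      define l where "l = j - (p - n)"
      have j: "j = p - n + l" "\<not> i + l < n" "\<not> i + l < p" "l < n"
        using 3(1) m assms unfolding l_def by linarith+
      have "f = basis_elem p n i l" using j(2,3) 3(3) by (simp add: basis_elem_def m(1) j(1))
      then show ?thesis using m(3) j(4) by (rule R)
    qed
  qed
  show "?R \<subseteq> basisS p n"
  proof safe
    fix i j assume ij: "i < p" "j < n"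
    consider "i + j < n" | "\<not> i + j < n" "i + j < p" | "\<not> i + j < n" "\<not> i + j < p" by blast
    then show "basis_elem p n i j \<in> (basisS p n :: 'k poly4 set)"
    proof cases
      case 1
      then have "X1 ^ i * X2 ^ j \<in> (Mk p (i + j) :: 'k poly4 set)" "i + j \<in> {0..<n}"
        using ij assms unfolding Mk_def by (force, simp)
      then have "X1 ^ i * X2 ^ j \<in> (basisS p n :: 'k poly4 set)" unfolding basisS_def by blast
      with 1 show ?thesis by (simp add: basis_elem_def)
    next
      case 2
      define k where "k = i + j - (n - 1)"
      have "n - 1 - j + j = n - 1" "n - 1 - j < p" "j < p" using ij assms by linarith+
      then have "X1 ^ (n - 1 - j) * X2 ^ j \<in> (Mk p (n - 1) :: 'k poly4 set)" unfolding Mk_def by blast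
      moreover have "k \<in> {1..p-n}" using 2 assms unfolding k_def atLeastAtMost_iff by linarith
      ultimately have "u4 ^ k * (X1 ^ (n - 1 - j) * X2 ^ j) \<in> (basisS p n :: 'k poly4 set)"
        unfolding basisS_def by blast
      with 2 show ?thesis by (simp add: basis_elem_def k_def)
    next
      case 3
      have "p - n + j < p" using ij assms by linarith
      then have "X1 ^ i * X2 ^ (p - n + j) \<in> (Mk p (i + (p - n + j)) :: 'k poly4 set)"
        using ij(1) unfolding Mk_def by blast
      moreover have "i + (p - n + j) \<in> {2*p-n..2*p-2}"
        using 3 ij assms unfolding atLeastAtMost_iff by linarith
      ultimately have "(Delta4 ^^ (p - n)) (X1 ^ i * X2 ^ (p - n + j)) \<in> (basisS p n :: 'k poly4 set)"
        unfolding basisS_def by blast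
      with 3 show ?thesis by (simp add: basis_elem_def)
    qed
  qed
qed

text \<open>Modulo \<open>X3\<close>, \<open>u4\<close> becomes \<open>X1 * X4\<close> and
  \<open>Delta4\<close> acts on \<open>X2\<close> alone. The leading coefficients are 1 on
  \<open>M\<close>, \<open>X4 ^ k\<close> on \<open>U\<close>, and a nonzero constant times
  \<open>X4 ^ (p - n)\<close> on \<open>D\<close>.\<close>

lemma leads_mod_X3_basis_elem:
  assumes "prime p" and "CHAR('k::field) = p" and "1 \<le> n" and "n \<le> p" and "i < p" and "j < n"
  shows "leads_mod_X3 p i j (basis_elem p n i j :: 'k poly4)"
proof -
  consider "i + j < n" | "\<not> i + j < n" "i + j < p" | "\<not> i + j < n" "\<not> i + j < p" by blast
  then show ?thesis
  proof cases
    case 1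
    then have "basis_elem p n i j - (const4 1 * X4 ^ 0 * (X1 ^ i * X2 ^ j) + X1 ^ i * 0) = (0 :: 'k poly4)"
      by (simp add: basis_elem_def const4_hom)
    then show ?thesis by (intro leads_mod_X3I[where e = 0, OF one_neq_zero hull.zero]) (simp only: dvd_0_right)
  next
    case 2
    define k where "k = i + j - (n - 1)"
    have i: "i = k + (n - 1 - j)" using 2 assms unfolding k_def by linarith
    have "X3 dvd (u4 ^ k - (X1 * X4) ^ k :: 'k poly4)"
      by (rule X3_dvd_diff_power) (simp add: u4_def)
    then have "X3 dvd (u4 ^ k - (X1 * X4) ^ k) * (X1 ^ (n - 1 - j) * X2 ^ j :: 'k poly4)" by (rule dvd_mult2)
    also have "(u4 ^ k - (X1 * X4) ^ k) * (X1 ^ (n - 1 - j) * X2 ^ j :: 'k poly4)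
       = u4 ^ k * (X1 ^ (n - 1 - j) * X2 ^ j) - X4 ^ k * ((X1 ^ k * X1 ^ (n - 1 - j)) * X2 ^ j)"
      by (simp add: power_mult_distrib algebra_simps)
    also have "u4 ^ k * (X1 ^ (n - 1 - j) * X2 ^ j) = (basis_elem p n i j :: 'k poly4)"
      using 2 by (simp add: basis_elem_def k_def)
    also have "X1 ^ k * X1 ^ (n - 1 - j) = (X1 ^ i :: 'k poly4)"
      using i by (metis power_add)
    finally have "X3 dvd basis_elem p n i j - (const4 1 * X4 ^ k * (X1 ^ i * X2 ^ j) + X1 ^ i * (0 :: 'k poly4))"
      by (simp add: const4_hom)
    then show ?thesis by (rule leads_mod_X3I[OF one_neq_zero hull.zero])
  next
    case 3
    have "p - n + j < p" using assms by linarith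
    then obtain c where c: "c \<noteq> 0"
      "(Delta4 ^^ (p - n)) (X2 ^ (p - n + j)) - const4 c * X4 ^ (p - n) * X2 ^ j \<in> (X2_polys p j :: 'k poly4 set)"
      (is "?r \<in> _")
      using Delta4_pow_X2_power[OF assms(1,2)] by blast
    have "X3 dvd (Delta4 ^^ (p - n)) (X1 ^ i * X2 ^ (p - n + j)) - X1 ^ i * (Delta4 ^^ (p - n)) (X2 ^ (p - n + j) :: 'k poly4)"
      by (rule Delta4_pow_X1_times_cong)
    also have "X1 ^ i * (Delta4 ^^ (p - n)) (X2 ^ (p - n + j)) = const4 c * X4 ^ (p - n) * (X1 ^ i * X2 ^ j) + X1 ^ i * ?r"
      by (simp add: algebra_simps)
    also have "(Delta4 ^^ (p - n)) (X1 ^ i * X2 ^ (p - n + j)) = (basis_elem p n i j :: 'k poly4)"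
      using 3 by (simp add: basis_elem_def)
    finally show ?thesis by (rule leads_mod_X3I[OF c])
  qed
qed

lemma basisS_subset_Kn:
  assumes "prime p" and "CHAR('k::field) = p" and "1 \<le> n" and "n \<le> p"
  shows "basisS p n \<subseteq> (Kn n :: 'k poly4 set)"
proof
  fix f :: "'k poly4" assume "f \<in> basisS p n"
  then consider k where "k < n" "f \<in> Mk p k"
    | k m where "m \<in> Mk p (n - 1)" "f = u4 ^ k * m"
    | k m where "m \<in> Mk p k" "f = (Delta4 ^^ (p - n)) m"
    unfolding basisS_def by auto
  then show "f \<in> Kn n"
  proof cases
    case 1
    then show ?thesis
      by (auto simp: Mk_def Kn_def Delta4_pow_monomial_eq_0[OF assms(1,2)])
  next
    case 2
    then show ?thesis
      using assms(3) by (auto simp: Mk_def Kn_def Delta4_pow_times Delta4_pow_monomial_eq_0[OF assms(1,2)])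
  next
    case 3
    then show ?thesis
      using assms(4) by (auto simp: Mk_def Kn_def Delta4_pow_pow Delta4_pow_p_monomial[OF assms(1,2)])
  qed
qed

text \<open>By \<open>ind\<close>, whenever \<open>X3\<close> divides a combination, the whole
  combination can be divided by \<open>X3\<close> inside \<open>algA p\<close>. Repeating this shows
  both independence and that powers of \<open>X3\<close> cancel in the span, so \<open>loc\<close>
  gives generation.\<close>

lemma free_basis_by_saturation:
  fixes s :: "'i \<Rightarrow> 'k::field poly4"
  assumes "1 < p" and fin: "finite I" and sub: "s ` I \<subseteq> N"
    and ind: "\<And>a x. \<lbrakk>\<And>x. a x \<in> algA p; X3 dvd (\<Sum>x\<in>I. a x * s x); x \<in> I\<rbrakk> \<Longrightarrow> X3 dvd a x"
    and loc: "\<And>f. f \<in> N \<Longrightarrow> \<exists>m. X3 ^ m * f \<in> hull (algA p) (s ` I)"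
  shows "free_basis (algA p) N (s ` I)"
proof -
  have divide: "\<exists>b. (\<forall>x. b x \<in> algA p) \<and> (\<forall>x\<in>I. a x = X3 * b x)"
    if "\<And>x. a x \<in> algA p" "X3 dvd (\<Sum>x\<in>I. a x * s x)" for a
  proof -
    have "\<exists>b. b \<in> algA p \<and> (x \<in> I \<longrightarrow> a x = X3 * b)" for x
    proof (cases "x \<in> I")
      case True
      then have "X3 dvd a x" using ind[of a] that by blast
      then show ?thesis using algA_X3_dvdD[OF assms(1) that(1)] by blast
    next
      case False
      then show ?thesis using algA.zero_mem by blast
    qed
    then show ?thesis by metis
  qed
  have zero: "a x = 0" if "\<And>x. a x \<in> algA p" "(\<Sum>x\<in>I. a x * s x) = 0" "x \<in> I" for a x
  proof (rule X3_power_dvd_all_imp_0)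
    fix m
    show "X3 ^ m dvd a x"
      using that
    proof (induction m arbitrary: a)
      case (Suc m)
      obtain b where b: "\<And>x. b x \<in> algA p" "\<And>x. x \<in> I \<Longrightarrow> a x = X3 * b x"
        using divide[of a] Suc.prems(1,2) by auto
      have "X3 * (\<Sum>x\<in>I. b x * s x) = (\<Sum>x\<in>I. a x * s x)"
        unfolding sum_distrib_left by (intro sum.cong refl) (simp add: b(2) mult.assoc)
      then have "(\<Sum>x\<in>I. b x * s x) = 0" unfolding Suc.prems(2) by (rule X3_times_eq_0D)
      then have "X3 ^ m dvd b x" by (intro Suc.IH[of b] b(1) Suc.prems(3))
      then show ?case using b(2)[OF Suc.prems(3)] by (simp add: mult_dvd_mono)
    qed simp
  qed
  have saturated: "f \<in> hull (algA p) (s ` I)" if "X3 ^ m * f \<in> hull (algA p) (s ` I)" for m f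
    using that
  proof (induction m)
    case (Suc m)
    obtain a where a: "\<And>x. a x \<in> algA p" "X3 ^ Suc m * f = (\<Sum>x\<in>I. a x * s x)"
      using algA.hull_family[OF Suc.prems fin] by blast
    have "X3 dvd X3 ^ Suc m * f" by simp
    then have "X3 dvd (\<Sum>x\<in>I. a x * s x)" unfolding a(2) .
    then obtain b where b: "\<And>x. b x \<in> algA p" "\<And>x. x \<in> I \<Longrightarrow> a x = X3 * b x"
      using divide[of a, OF a(1)] by auto
    have "X3 * (\<Sum>x\<in>I. b x * s x) = (\<Sum>x\<in>I. a x * s x)"
      unfolding sum_distrib_left by (intro sum.cong refl) (simp add: b(2) mult.assoc)
    also have "\<dots> = X3 * (X3 ^ m * f)" by (simp add: mult.assoc flip: a(2))
    finally have f: "X3 ^ m * f = (\<Sum>x\<in>I. b x * s x)" by (simp add: X3_times_cancel)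
    have "b x * s x \<in> hull (algA p) (s ` I)" if "x \<in> I" for x
      using that by (intro algA.hull_scale[OF algA.hull_base] b(1)) simp
    then have "X3 ^ m * f \<in> hull (algA p) (s ` I)" unfolding f by (rule hull_sum)
    then show ?case by (rule Suc.IH)
  qed simp
  \<comment> \<open>\<open>free_basis\<close> concerns a set, so indices must correspond to
    elements: a repetition would be a relation with coefficients 1 and -1.\<close>
  have inj: "inj_on s I"
  proof (rule inj_onI, rule ccontr)
    fix x y assume xy: "x \<in> I" "y \<in> I" "s x = s y" "x \<noteq> y"
    define a :: "'i \<Rightarrow> 'k poly4" where "a = (\<lambda>z. (if z = x then 1 else 0) - (if z = y then 1 else 0))"
    have A: "a z \<in> algA p" for z
      unfolding a_def by (intro algA.diff_mem) (simp_all add: algA.one_mem algA.zero_mem)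
    have "(\<Sum>z\<in>I. a z * s z) = (\<Sum>z\<in>I. (if z = x then s z else 0) - (if z = y then s z else 0))"
      by (intro sum.cong refl) (simp add: a_def)
    also have "\<dots> = 0" using xy fin by (simp add: sum_subtractf)
    finally have "a x = 0" by (rule zero[of a, OF A _ xy(1)])
    then show False using xy(4) by (simp add: a_def)
  qed
  have span: "\<exists>T a. finite T \<and> T \<subseteq> s ` I \<and> (\<forall>t\<in>T. a t \<in> algA p) \<and> f = (\<Sum>t\<in>T. a t * t)"
    if fN: "f \<in> N" for f
  proof -
    obtain m where "X3 ^ m * f \<in> hull (algA p) (s ` I)" using loc[OF fN] ..
    then have "f \<in> hull (algA p) (s ` I)" by (rule saturated)
    from algA.hull_family[OF this fin] obtain a
      where a: "\<And>x. a x \<in> algA p" "f = (\<Sum>x\<in>I. a x * s x)" by blast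
    have "f = (\<Sum>t\<in>s ` I. a (inv_into I s t) * t)"
      unfolding a(2) sum.reindex[OF inj] by (intro sum.cong) (simp_all add: inj)
    then show ?thesis
      using a(1) fin by (intro exI[of _ "s ` I"] exI[of _ "\<lambda>t. a (inv_into I s t)"] conjI) simp_all
  qed
  have indep: "a t = 0"
    if T: "T \<subseteq> s ` I" "\<forall>t\<in>T. a t \<in> algA p" "(\<Sum>t\<in>T. a t * t) = 0" "t \<in> T" for T a t
  proof -
    define b where "b = (\<lambda>x. if s x \<in> T then a (s x) else 0)"
    have A: "b x \<in> algA p" for x using T(2) by (simp add: b_def algA.zero_mem)
    have "(\<Sum>x\<in>I. b x * s x) = (\<Sum>t\<in>s ` I. (if t \<in> T then a t else 0) * t)"
      unfolding sum.reindex[OF inj] by (simp add: b_def)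
    also have "\<dots> = (\<Sum>t\<in>T. (if t \<in> T then a t else 0) * t)"
      using T(1) fin by (intro sum.mono_neutral_right) auto
    also have "\<dots> = 0" using T(3) by simp
    finally have *: "(\<Sum>x\<in>I. b x * s x) = 0" .
    obtain x where x: "x \<in> I" "t = s x" using T(1,4) by blast
    then show ?thesis using zero[OF A * x(1)] T(4) by (simp add: b_def)
  qed
  show ?thesis
    unfolding free_basis_def
  proof (intro conjI ballI allI impI)
    fix T a t assume "finite T \<and> T \<subseteq> s ` I \<and> (\<forall>t\<in>T. a t \<in> algA p) \<and> (\<Sum>t\<in>T. a t * t) = 0" "t \<in> T"
    then show "a t = 0" by (intro indep[of T a t]) simp_all
  qed (simp_all only: sub span)
qed

theorem theorem4p16:
  fixes p n :: nat
  assumes "prime p" and "CHAR('k::field) = p"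
    and "1 \<le> n" and "n \<le> p"
  shows "free_basis (algA p :: 'k poly4 set) (Kn n) (basisS p n)"
proof -
  let ?s = "\<lambda>(i,j). basis_elem p n i j :: 'k poly4" and ?I = "{..<p} \<times> {..<n}"
  have p: "1 < p" using assms(1) by (rule prime_gt_1_nat)
  have S: "basisS p n = ?s ` ?I" using basisS_eq_image assms(3,4) .
  have "free_basis (algA p) (Kn n) (?s ` ?I)"
  proof (rule free_basis_by_saturation[OF p])
    show "?s ` ?I \<subseteq> Kn n" using basisS_subset_Kn[OF assms] unfolding S .
    show "\<exists>m. X3 ^ m * f \<in> hull (algA p) (?s ` ?I)" if "f \<in> Kn n" for f
      using Kn_localized_span[OF assms that] unfolding S .
    fix a :: "nat \<times> nat \<Rightarrow> 'k poly4" and x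
    assume a: "\<And>x. a x \<in> algA p" "X3 dvd (\<Sum>x\<in>?I. a x * ?s x)" "x \<in> ?I"
    obtain i j where x: "x = (i,j)" "i < p" "j < n" using a(3) by auto
    have "(\<Sum>x\<in>?I. a x * ?s x) = (\<Sum>j<n. \<Sum>i<p. a (i,j) * basis_elem p n i j)"
      by (subst sum.swap) (simp add: sum.cartesian_product split_def)
    with a(2) have "X3 dvd (\<Sum>j<n. \<Sum>i<p. a (i,j) * basis_elem p n i j)" by simp
    then show "X3 dvd a x"
      unfolding x(1)
      by (intro leads_mod_X3_independent[where a = "\<lambda>i j. a (i,j)", OF p assms(4) a(1)
            leads_mod_X3_basis_elem[OF assms] _ x(2,3)])
  qed simp
  then show ?thesis unfolding S .
qed

end
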